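(* Let $m$ be a fixed positive integer. The asymptotic probability (as $n\to\infty$) that a uniformly random quadratic square-tiled surface $s\in\mathcal{QSS}$ of size $n$ has $m$ connected components satisfies $$\mathbb P(s\text{ has }m\text{ connected components})\approx\sum_{k\ge0}\mathfrak d_{k,m}(\mathcal{QSS})\cdot\binom nk\cdot\left(\frac{(2(n-k)-1)!!}{(2n-1)!!}\right)^2,$$ where $$\begin{aligned}\mathfrak d_{k,m}(\mathcal{QSS})&=\#\{(s',s'')\in\mathcal{QSS}_i\cdot\mathcal{QSS}_{k-i}\mid0\le i\le k,\ \pi_0(s')=m-1,\ \pi_0(s'')\text{ is even}\}\\&\quad-\#\{(s',s'')\in\mathcal{QSS}_i\cdot\mathcal{QSS}_{k-i}\mid0\le i\le k,\ \pi_0(s')=m-1,\ \pi_0(s'')\text{ is odd}\}\end{aligned}$$ and $\pi_0(s)$ is the number of connected components of the surface $s$.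
   Context: A quadratic square-tiled surface of size $n$ is an oriented surface obtained by gluing $n$ unit squares, labeled by $[n]=\{1,\dots,n\}$ (or any set of size $n$), so that horizontal sides are glued to horizontal sides and vertical sides to vertical sides; gluing sides of the same square together is allowed. Combinatorially it is a pair consisting of a perfect matching of the $2n$ horizontal sides and a perfect matching of the $2n$ vertical sides, so there are $((2n-1)!!)^2$ of them (with $(-1)!!=1$; for $n=0$ there is one, the empty surface, with $0$ components). Two squares are in the same connected component if they are linked by a chain of squares successively glued along sides. $\mathcal{QSS}_i$ denotes quadratic square-tiled surfaces of size $i$; $(s',s'')\in\mathcal{QSS}_i\cdot\mathcal{QSS}_{k-i}$ means an ordered pair such that, for some decomposition $[k]=U'\sqcup U''$ with $|U'|=i$, $|U''|=k-i$, $s'$ is a quadratic square-tiled surface with squares labeled by $U'$ and $s''$ one with squares labeled by $U''$ (all decompositions are counted). Notation $\approx$: $p_n\approx\sum_{k\ge0}c_kg_k(n)$ (here $g_k(n)=\binom nk\big((2(n-k)-1)!!/(2n-1)!!\big)^2$) means that $g_{k+1}(n)=o(g_k(n))$ for every $k$ and, for every integer $r\ge0$, $p_n=\sum_{k=0}^rc_kg_k(n)+O(g_{r+1}(n))$ as $n\to\infty$. *)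

theory Defs
  imports "HOL-Probability.Probability" "HOL-Library.Landau_Symbols" "HOL-Library.Disjoint_Sets"
begin

definition perfect_matching :: "'a set \<Rightarrow> 'a set set \<Rightarrow> bool" where
  "perfect_matching S M \<longleftrightarrow> partition_on S M \<and> (\<forall>e\<in>M. card e = 2)"

datatype hside = Top | Bottom
datatype vside = Left | Right

text \<open>Two sides of the same kind can be glued in exactly one orientation-compatible way
  (by a translation or by a rotation by the angle \<open>\<pi>\<close>), so the two matchings determine
  the surface.\<close>

record 'a surface =
  squares :: "'a set"
  hglue :: "('a \<times> hside) set set"
  vglue :: "('a \<times> vside) set set"

definition qss :: "'a set \<Rightarrow> 'a surface set" where
  "qss U = {s. squares s = U \<and>
     perfect_matching (U \<times> UNIV) (hglue s) \<and> perfect_matching (U \<times> UNIV) (vglue s)}"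

definition glued :: "'a surface \<Rightarrow> ('a \<times> 'a) set" where
  "glued s = {(a, b). (\<exists>x y. {(a, x), (b, y)} \<in> hglue s) \<or> (\<exists>x y. {(a, x), (b, y)} \<in> vglue s)}"

definition components :: "'a surface \<Rightarrow> 'a set set" where
  "components s = squares s // (glued s)\<^sup>*"

definition pi0 :: "'a surface \<Rightarrow> nat" where
  "pi0 s = card (components s)"

text \<open>The product \<open>QSS\<^sub>i \<cdot> QSS\<^sub>j\<close> of labelled classes.\<close>

definition qss_prod :: "nat \<Rightarrow> nat \<Rightarrow> (nat surface \<times> nat surface) set" where
  "qss_prod i j = {(s', s''). \<exists>U' U''. U' \<union> U'' = {1..i + j} \<and> U' \<inter> U'' = {} \<and>
     card U' = i \<and> card U'' = j \<and> s' \<in> qss U' \<and> s'' \<in> qss U''}"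

definition qss_coeff :: "nat \<Rightarrow> nat \<Rightarrow> int" where
  "qss_coeff k m =
     int (card {(s', s''). \<exists>i\<in>{0..k}. (s', s'') \<in> qss_prod i (k - i) \<and> pi0 s' = m - 1 \<and> even (pi0 s'')})
   - int (card {(s', s''). \<exists>i\<in>{0..k}. (s', s'') \<in> qss_prod i (k - i) \<and> pi0 s' = m - 1 \<and> odd (pi0 s'')})"

fun double_fact :: "nat \<Rightarrow> nat" where
  "double_fact 0 = 1"
| "double_fact (Suc 0) = 1"
| "double_fact (Suc (Suc n)) = Suc (Suc n) * double_fact n"

text \<open>The convention \<open>(-1)!! = 1\<close> is covered by truncated subtraction:
  \<open>double_fact (2 * 0 - 1) = double_fact 0 = 1\<close>.  For \<open>k > n\<close> the binomial coefficient vanishes.\<close>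

definition qss_scale :: "nat \<Rightarrow> nat \<Rightarrow> real" where
  "qss_scale k n = real (n choose k) *
     (real (double_fact (2 * (n - k) - 1)) / real (double_fact (2 * n - 1)))\<^sup>2"

definition asymptotic_expansion ::
  "(nat \<Rightarrow> real) \<Rightarrow> (nat \<Rightarrow> real) \<Rightarrow> (nat \<Rightarrow> nat \<Rightarrow> real) \<Rightarrow> bool" where
  "asymptotic_expansion p c g \<longleftrightarrow>
     (\<forall>k. g (Suc k) \<in> o[at_top](g k)) \<and>
     (\<forall>r. (\<lambda>n. p n - (\<Sum>k\<le>r. c k * g k n)) \<in> O[at_top](g (Suc r)))"

text \<open>Finiteness and non-emptiness make the uniform distribution \<open>pmf_of_set (qss U)\<close> meaningful.\<close>

lemma UNIV_hside: "(UNIV :: hside set) = {Top, Bottom}"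
proof -
  have "x \<in> {Top, Bottom}" for x by (cases x) simp_all
  then show ?thesis by blast
qed

lemma UNIV_vside: "(UNIV :: vside set) = {Left, Right}"
proof -
  have "x \<in> {Left, Right}" for x by (cases x) simp_all
  then show ?thesis by blast
qed

lemma finite_qss:
  fixes U :: "'a set"
  assumes "finite U"
  shows "finite (qss U)"
proof -
  have "finite (UNIV :: hside set)" "finite (UNIV :: vside set)"
    by (simp_all add: UNIV_hside UNIV_vside)
  then have fin: "finite (Pow (Pow (U \<times> (UNIV :: hside set))))" "finite (Pow (Pow (U \<times> (UNIV :: vside set))))"
    using assms by auto
  have "qss U \<subseteq> (\<lambda>(h, v). \<lparr>squares = U, hglue = h, vglue = v\<rparr>) `
      (Pow (Pow (U \<times> UNIV)) \<times> Pow (Pow (U \<times> UNIV)))"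
  proof
    fix s assume "s \<in> qss U"
    then have "squares s = U" "hglue s \<subseteq> Pow (U \<times> UNIV)" "vglue s \<subseteq> Pow (U \<times> UNIV)"
      by (auto simp: qss_def perfect_matching_def partition_on_def)
    then show "s \<in> (\<lambda>(h, v). \<lparr>squares = U, hglue = h, vglue = v\<rparr>) `
      (Pow (Pow (U \<times> UNIV)) \<times> Pow (Pow (U \<times> UNIV)))"
      by (intro image_eqI[of _ _ "(hglue s, vglue s)"]) auto
  qed
  then show ?thesis
    using fin by (meson finite_SigmaI finite_imageI finite_subset)
qed

lemma qss_nonempty: "qss U \<noteq> {}"
proof -
  have c: "card (UNIV :: hside set) = 2" "card (UNIV :: vside set) = 2"
    by (simp_all add: UNIV_hside UNIV_vside)
  have pm: "perfect_matching (U \<times> UNIV) ((\<lambda>a. {a} \<times> (UNIV :: 'c set)) ` U)"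
    if "card (UNIV :: 'c set) = 2" for U :: "'b set"
    using that unfolding perfect_matching_def partition_on_def disjoint_def
    by (auto simp: card_cartesian_product)
  show ?thesis
    using pm[OF c(1), of U] pm[OF c(2), of U]
    unfolding qss_def ex_in_conv[symmetric] mem_Collect_eq
    by (intro exI[of _ "\<lparr>squares = U, hglue = (\<lambda>a. {a} \<times> UNIV) ` U,
          vglue = (\<lambda>a. {a} \<times> UNIV) ` U\<rparr>"]) simp
qed

end

theory Submission
  imports Defs "HOL-Computational_Algebra.Formal_Power_Series"
begin

text \<open>A random surface of size \<open>n\<close> has a component of size \<open>n - j\<close> with \<open>j \<le> r\<close>, up to probability
  \<open>O(n\<^sup>-\<^sup>r\<^sup>-\<^sup>1)\<close>: otherwise some union of components has size strictly between \<open>r\<close> and \<open>n - r\<close>, and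
  since \<open>(2n-1)!! \<ge> (n choose k) (2k-1)!! (2(n-k)-1)!!\<close>, a union of components of size \<open>k\<close> occurs
  with probability at most \<open>1 / (n choose k)\<close>. Splitting off this giant component expresses the number
  \<open>a\<^sub>n\<close> of all surfaces and the number of those with \<open>m\<close> components through the numbers of connected
  surfaces of size \<open>n - j\<close>. Substituting the expansion of \<open>a\<^sub>n\<^sub>-\<^sub>k\<close> into \<open>\<Sum>\<^sub>k d\<^sub>k (n choose k) a\<^sub>n\<^sub>-\<^sub>k\<close> and using
  that the labelled convolution \<open>d * a\<close> counts the surfaces with \<open>m - 1\<close> components (signs cancel
  over subsets of components, so the signed count is inverse to \<open>a\<close>) gives back the expansion for \<open>m\<close>
  components.\<close>

subsection \<open>Cutting a surface along a union of components\<close>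

lemma perfect_matching_restrict:
  assumes "perfect_matching S M" "T \<subseteq> S" "\<And>e. e \<in> M \<Longrightarrow> e \<subseteq> T \<or> e \<inter> T = {}"
  shows "perfect_matching T {e \<in> M. e \<subseteq> T}"
proof -
  have "\<Union> {e \<in> M. e \<subseteq> T} = T"
    using assms unfolding perfect_matching_def partition_on_def by blast
  moreover have "disjoint {e \<in> M. e \<subseteq> T}"
    using assms(1) by (auto simp: perfect_matching_def partition_on_def disjoint_def)
  ultimately show ?thesis
    using assms(1) by (auto simp: perfect_matching_def partition_on_def)
qed

lemma perfect_matching_Un:
  assumes "perfect_matching S M" "perfect_matching T N" "S \<inter> T = {}"
  shows "perfect_matching (S \<union> T) (M \<union> N)"
  using assms disjoint_union[of M N] by (auto simp: perfect_matching_def partition_on_def)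

text \<open>Closure in one direction suffices because \<open>glued\<close> is symmetric. The closed
  sets are the unions of components, but in this form they can be tested edge by edge, without
  reachability.\<close>

definition closed_in :: "'a surface \<Rightarrow> 'a set \<Rightarrow> bool" where
  "closed_in s W \<longleftrightarrow> W \<subseteq> squares s \<and> glued s `` W \<subseteq> W"

text \<open>Edges leaving \<open>W\<close> are discarded; closedness of \<open>W\<close> ensures
  that there are none.\<close>

definition restr :: "'a surface \<Rightarrow> 'a set \<Rightarrow> 'a surface" where
  "restr s W = \<lparr>squares = W, hglue = {e \<in> hglue s. e \<subseteq> W \<times> UNIV},
     vglue = {e \<in> vglue s. e \<subseteq> W \<times> UNIV}\<rparr>"

definition join :: "'a surface \<Rightarrow> 'a surface \<Rightarrow> 'a surface" where
  "join s t = \<lparr>squares = squares s \<union> squares t, hglue = hglue s \<union> hglue t,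
     vglue = vglue s \<union> vglue t\<rparr>"

lemma qssD:
  assumes "s \<in> qss U"
  shows "squares s = U" "perfect_matching (U \<times> UNIV) (hglue s)" "perfect_matching (U \<times> UNIV) (vglue s)"
  using assms by (auto simp: qss_def)

lemma perfect_matchingD:
  assumes "perfect_matching S M" "e \<in> M"
  shows "e \<subseteq> S" "e \<noteq> {}" "\<exists>p q. e = {p, q}"
proof -
  show "e \<subseteq> S" "e \<noteq> {}"
    using assms by (auto simp: perfect_matching_def partition_on_def)
  have "card e = 2" using assms by (simp add: perfect_matching_def)
  then show "\<exists>p q. e = {p, q}" by (auto simp: card_2_iff)
qed

lemma glued_sym: "sym (glued s)"
proof (rule symI)
  fix a b assume "(a, b) \<in> glued s"
  then obtain x y where "{(a, x), (b, y)} \<in> hglue s \<or> (\<exists>x y. {(a, x), (b, y)} \<in> vglue s)"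
    by (auto simp: glued_def)
  then show "(b, a) \<in> glued s"
  proof (elim disjE exE)
    assume "{(a, x), (b, y)} \<in> hglue s"
    then have "{(b, y), (a, x)} \<in> hglue s" by (subst insert_commute)
    then show ?thesis by (auto simp: glued_def)
  next
    fix x y assume "{(a, x), (b, y)} \<in> vglue s"
    then have "{(b, y), (a, x)} \<in> vglue s" by (subst insert_commute)
    then show ?thesis by (auto simp: glued_def)
  qed
qed

lemma glued_subset:
  assumes "s \<in> qss U"
  shows "glued s \<subseteq> U \<times> U"
proof
  fix p assume "p \<in> glued s"
  then obtain a b where p: "p = (a, b)"
    "(\<exists>x y. {(a, x), (b, y)} \<in> hglue s) \<or> (\<exists>x y. {(a, x), (b, y)} \<in> vglue s)"
    unfolding glued_def by blast
  then show "p \<in> U \<times> U"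
    using perfect_matchingD(1)[OF qssD(2)[OF assms]] perfect_matchingD(1)[OF qssD(3)[OF assms]]
    by (elim disjE exE) force+
qed

lemma closed_in_Diff:
  assumes "s \<in> qss U" "closed_in s W"
  shows "closed_in s (U - W)"
  using assms glued_subset[OF assms(1)] symD[OF glued_sym[of s]] qssD(1)[OF assms(1)]
  unfolding closed_in_def by blast

lemma closed_in_edge:
  assumes "s \<in> qss U" "closed_in s W"
  shows "e \<in> hglue s \<Longrightarrow> e \<subseteq> W \<times> UNIV \<or> e \<inter> W \<times> UNIV = {}"
    and "f \<in> vglue s \<Longrightarrow> f \<subseteq> W \<times> UNIV \<or> f \<inter> W \<times> UNIV = {}"
proof -
  assume e: "e \<in> hglue s"
  then obtain a x b y where "e = {(a, x), (b, y)}"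
    using perfect_matchingD(3)[OF qssD(2)[OF assms(1)]] by (metis surj_pair)
  with e have "(a, b) \<in> glued s" unfolding glued_def by auto
  then have "(a, b) \<in> glued s" "(b, a) \<in> glued s" using symD[OF glued_sym] by auto
  then show "e \<subseteq> W \<times> UNIV \<or> e \<inter> W \<times> UNIV = {}"
    using assms(2) \<open>e = _\<close> unfolding closed_in_def by auto
next
  assume e: "f \<in> vglue s"
  then obtain a x b y where "f = {(a, x), (b, y)}"
    using perfect_matchingD(3)[OF qssD(3)[OF assms(1)]] by (metis surj_pair)
  with e have "(a, b) \<in> glued s" unfolding glued_def by auto
  then have "(a, b) \<in> glued s" "(b, a) \<in> glued s" using symD[OF glued_sym] by auto
  then show "f \<subseteq> W \<times> UNIV \<or> f \<inter> W \<times> UNIV = {}"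
    using assms(2) \<open>f = _\<close> unfolding closed_in_def by auto
qed

lemma restr_in_qss:
  assumes "s \<in> qss U" "closed_in s W"
  shows "restr s W \<in> qss W"
proof -
  have "W \<subseteq> U" using assms qssD(1) by (auto simp: closed_in_def)
  then show ?thesis
    using perfect_matching_restrict[OF qssD(2)[OF assms(1)], of "W \<times> UNIV"]
      perfect_matching_restrict[OF qssD(3)[OF assms(1)], of "W \<times> UNIV"]
      closed_in_edge[OF assms]
    unfolding qss_def restr_def by (auto simp: Sigma_mono)
qed

lemma join_in_qss:
  assumes "s \<in> qss U" "t \<in> qss V" "U \<inter> V = {}"
  shows "join s t \<in> qss (U \<union> V)"
  using perfect_matching_Un[OF qssD(2)[OF assms(1)] qssD(2)[OF assms(2)]]
    perfect_matching_Un[OF qssD(3)[OF assms(1)] qssD(3)[OF assms(2)]]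
    qssD(1)[OF assms(1)] qssD(1)[OF assms(2)] assms(3)
  unfolding qss_def join_def by (auto simp: Sigma_Un_distrib1 Times_Int_distrib1)

lemma join_restr:
  assumes "s \<in> qss U" "closed_in s W"
  shows "join (restr s W) (restr s (U - W)) = s"
proof -
  have "W \<subseteq> U" using assms qssD(1) by (auto simp: closed_in_def)
  moreover have "e \<subseteq> W \<times> UNIV \<or> e \<subseteq> (U - W) \<times> UNIV" if "e \<in> hglue s" for e
    using closed_in_edge(1)[OF assms that] perfect_matchingD(1)[OF qssD(2)[OF assms(1)] that] by blast
  moreover have "e \<subseteq> W \<times> UNIV \<or> e \<subseteq> (U - W) \<times> UNIV" if "e \<in> vglue s" for e
    using closed_in_edge(2)[OF assms that] perfect_matchingD(1)[OF qssD(3)[OF assms(1)] that] by blast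
  ultimately show ?thesis
    using qssD(1)[OF assms(1)] unfolding join_def restr_def by (auto intro!: surface.equality)
qed

lemma closed_in_join:
  assumes "s \<in> qss U" "t \<in> qss V" "U \<inter> V = {}"
  shows "closed_in (join s t) U"
proof -
  have "glued (join s t) = glued s \<union> glued t"
    by (auto simp: glued_def join_def)
  then show ?thesis
    using glued_subset[OF assms(1)] glued_subset[OF assms(2)] assms(3) qssD(1)[OF assms(1)]
    by (auto simp: closed_in_def join_def)
qed

lemma join_commute: "join s t = join t s"
  by (simp add: join_def Un_commute)

lemma restr_join:
  assumes "s \<in> qss U" "t \<in> qss V" "U \<inter> V = {}"
  shows "restr (join s t) U = s"
proof -
  have "{e \<in> hglue s \<union> hglue t. e \<subseteq> U \<times> UNIV} = hglue s"
    using perfect_matchingD(1)[OF qssD(2)[OF assms(1)]] perfect_matchingD(1,2)[OF qssD(2)[OF assms(2)]] assms(3)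
    by fastforce
  moreover have "{e \<in> vglue s \<union> vglue t. e \<subseteq> U \<times> UNIV} = vglue s"
    using perfect_matchingD(1)[OF qssD(3)[OF assms(1)]] perfect_matchingD(1,2)[OF qssD(3)[OF assms(2)]] assms(3)
    by fastforce
  ultimately show ?thesis
    using qssD(1)[OF assms(1)] unfolding restr_def join_def by (auto intro!: surface.equality)
qed

lemma finite_closed_in:
  assumes "finite U" "s \<in> qss U"
  shows "finite {W. closed_in s W}"
  using assms qssD(1) by (intro finite_subset[of "{W. closed_in s W}" "Pow U"]) (auto simp: closed_in_def)

text \<open>Cutting and joining are mutually inverse, so a surface with a chosen closed set amounts
  to a set \<open>W\<close> and two independent surfaces on \<open>W\<close> and on its complement.
  All the double counting below goes through this identity, with different weights
  \<open>\<phi>\<close>.\<close>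

lemma sum_closed_in:
  assumes "finite U"
  shows "(\<Sum>s\<in>qss U. \<Sum>W | closed_in s W. \<phi> W (restr s W) (restr s (U - W))) =
    (\<Sum>W\<in>Pow U. \<Sum>s\<in>qss W. \<Sum>t\<in>qss (U - W). \<phi> W s t)"
proof -
  have fin: "finite (qss W)" "finite (qss (U - W))" if "W \<subseteq> U" for W
    using that assms by (auto intro!: finite_qss dest: finite_subset)
  have "(\<Sum>s\<in>qss U. \<Sum>W | closed_in s W. \<phi> W (restr s W) (restr s (U - W))) =
    (\<Sum>(s, W)\<in>(SIGMA s:qss U. {W. closed_in s W}). \<phi> W (restr s W) (restr s (U - W)))"
    using assms by (intro sum.Sigma) (auto intro: finite_closed_in finite_qss)
  also have "\<dots> = (\<Sum>(W, s, t)\<in>(SIGMA W:Pow U. qss W \<times> qss (U - W)). \<phi> W s t)"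
  proof (rule sum.reindex_bij_witness[where i = "\<lambda>(W, s, t). (join s t, W)"
        and j = "\<lambda>(s, W). (W, restr s W, restr s (U - W))"], goal_cases)
    case (1 p)
    then show ?case by (auto simp: join_restr)
  next
    case (2 p)
    then obtain s W where p: "p = (s, W)" "s \<in> qss U" "closed_in s W" by auto
    moreover from p have "W \<subseteq> U" using qssD(1) by (auto simp: closed_in_def)
    ultimately show ?case
      using restr_in_qss[OF p(2,3)] restr_in_qss[OF p(2) closed_in_Diff[OF p(2,3)]] by simp
  next
    case (3 q)
    then obtain W s t where "q = (W, s, t)" "W \<subseteq> U" "s \<in> qss W" "t \<in> qss (U - W)" by auto
    then show ?case
      using restr_join[of s W t "U - W"] restr_join[of t "U - W" s W] by (auto simp: join_commute)
  next
    case (4 q)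
    then obtain W s t where "q = (W, s, t)" "W \<subseteq> U" "s \<in> qss W" "t \<in> qss (U - W)" by auto
    then show ?case
      using join_in_qss[of s W t "U - W"] closed_in_join[of s W t "U - W"]
      by (auto simp: Un_absorb1)
  next
    case (5 p)
    then show ?case by auto
  qed
  also have "\<dots> = (\<Sum>W\<in>Pow U. \<Sum>s\<in>qss W. \<Sum>t\<in>qss (U - W). \<phi> W s t)"
    unfolding sum.cartesian_product using assms fin
    by (subst sum.Sigma) (auto intro!: sum.cong)
  finally show ?thesis .
qed

section \<open>Components and closed sets\<close>

lemma rtrancl_Image_closed_in:
  assumes "closed_in s W" "x \<in> W"
  shows "(glued s)\<^sup>* `` {x} \<subseteq> W"
proof
  fix y assume "y \<in> (glued s)\<^sup>* `` {x}"
  then have "(x, y) \<in> (glued s)\<^sup>*" by simp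
  then show "y \<in> W"
    by induction (use assms in \<open>auto simp: closed_in_def\<close>)
qed

lemma equiv_glued: "equiv UNIV ((glued s)\<^sup>*)"
  by (intro equivI refl_rtrancl sym_rtrancl trans_rtrancl glued_sym) auto

lemma closed_in_squares: "s \<in> qss U \<Longrightarrow> closed_in s U"
  using glued_subset qssD(1) by (fastforce simp: closed_in_def)

lemma components_subset_quotient: "components s \<subseteq> UNIV // (glued s)\<^sup>*"
  by (auto simp: components_def quotient_def)

lemma component_subset:
  assumes "closed_in s W" "K \<in> components s" "K \<inter> W \<noteq> {}"
  shows "K \<subseteq> W"
proof -
  obtain y where y: "y \<in> K" "y \<in> W" using assms(3) by auto
  obtain x where x: "K = (glued s)\<^sup>* `` {x}"
    using assms(2) by (auto simp: components_def quotient_def)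
  then have "K = (glued s)\<^sup>* `` {y}"
    using y(1) equiv_class_eq[OF equiv_glued, of x y s] by simp
  then show ?thesis using rtrancl_Image_closed_in[OF assms(1) y(2)] by simp
qed

lemma partition_on_components:
  assumes "s \<in> qss U"
  shows "partition_on U (components s)"
proof (rule partition_onI)
  show "\<Union> (components s) = U"
    using rtrancl_Image_closed_in[OF closed_in_squares[OF assms]] qssD(1)[OF assms]
    unfolding components_def quotient_def by blast
  show "{} \<notin> components s"
    using in_quotient_imp_non_empty[OF equiv_glued] components_subset_quotient by blast
  show "disjnt p q" if "p \<in> components s" "q \<in> components s" "p \<noteq> q" for p q
    using quotient_disj[OF equiv_glued, of p s q] that components_subset_quotient[of s]
    unfolding disjnt_def by blast
qed

lemma components_nonempty: "K \<in> components s \<Longrightarrow> K \<noteq> {}"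
  using in_quotient_imp_non_empty[OF equiv_glued] components_subset_quotient by blast

lemma finite_components:
  assumes "finite U" "s \<in> qss U"
  shows "finite (components s)"
  using finite_elements[OF assms(1) partition_on_components[OF assms(2)]] .

lemma closed_in_Union:
  assumes "s \<in> qss U" "B \<subseteq> components s"
  shows "closed_in s (\<Union>B)"
proof -
  have "glued s `` K \<subseteq> K" if "K \<in> components s" for K
  proof
    fix y assume "y \<in> glued s `` K"
    then obtain x where "x \<in> K" "(x, y) \<in> (glued s)\<^sup>*" by blast
    then show "y \<in> K"
      using in_quotient_imp_closed[OF equiv_glued, of K s x y] that components_subset_quotient by blast
  qed
  moreover have "\<Union>B \<subseteq> squares s"
    using partition_onD1[OF partition_on_components[OF assms(1)]] assms(2) qssD(1)[OF assms(1)] by blast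
  ultimately show ?thesis using assms(2) unfolding closed_in_def by blast
qed

lemma closed_in_component: "s \<in> qss U \<Longrightarrow> K \<in> components s \<Longrightarrow> closed_in s K"
  using closed_in_Union[of s U "{K}"] by simp

lemma Union_components_closed_in:
  assumes "s \<in> qss U" "closed_in s W"
  shows "\<Union> {K \<in> components s. K \<subseteq> W} = W"
proof -
  have "W \<subseteq> \<Union> (components s)"
    using partition_onD1[OF partition_on_components[OF assms(1)]] assms(2) qssD(1)[OF assms(1)]
    unfolding closed_in_def by simp
  then show ?thesis using component_subset[OF assms(2)] by blast
qed

text \<open>A path of gluings that starts in a closed set never leaves it, so discarding the edges
  outside does not change reachability from its points.\<close>

lemma components_restr:
  assumes "s \<in> qss U" "closed_in s W"
  shows "components (restr s W) = {K \<in> components s. K \<subseteq> W}"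
proof -
  let ?R = "glued s" and ?Q = "glued (restr s W)"
  have QR: "?Q \<subseteq> ?R" unfolding glued_def restr_def by auto
  have RQ: "(a, b) \<in> ?Q" if "(a, b) \<in> ?R" "a \<in> W" for a b
  proof -
    have "b \<in> W" using that assms(2) by (auto simp: closed_in_def)
    then show ?thesis using that unfolding glued_def restr_def by auto
  qed
  have eq: "?Q\<^sup>* `` {x} = ?R\<^sup>* `` {x}" if "x \<in> W" for x
  proof -
    have "(x, y) \<in> ?Q\<^sup>*" if "(x, y) \<in> ?R\<^sup>*" for y
      using that
    proof induction
      case (step y z)
      have "y \<in> W" using rtrancl_Image_closed_in[OF assms(2) \<open>x \<in> W\<close>] step(1) by auto
      then show ?case using step RQ by (meson rtrancl.rtrancl_into_rtrancl)
    qed simp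
    then show ?thesis using rtrancl_mono[OF QR] by auto
  qed
  have "components (restr s W) = (\<lambda>x. ?R\<^sup>* `` {x}) ` W"
    using eq by (auto simp: components_def quotient_def restr_def)
  also have "\<dots> = {K \<in> components s. K \<subseteq> W}"
  proof (intro equalityI subsetI)
    fix K assume "K \<in> (\<lambda>x. ?R\<^sup>* `` {x}) ` W"
    then show "K \<in> {K \<in> components s. K \<subseteq> W}"
      using rtrancl_Image_closed_in[OF assms(2)] assms(2)
      by (auto simp: components_def closed_in_def intro!: quotientI)
  next
    fix K assume "K \<in> {K \<in> components s. K \<subseteq> W}"
    then obtain x where "K = ?R\<^sup>* `` {x}" "K \<subseteq> W" by (auto simp: components_def quotient_def)
    then show "K \<in> (\<lambda>x. ?R\<^sup>* `` {x}) ` W" by auto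
  qed
  finally show ?thesis .
qed

lemma pi0_restr:
  assumes "finite U" "s \<in> qss U" "closed_in s W"
  shows "pi0 s = pi0 (restr s W) + pi0 (restr s (U - W))"
proof -
  have "components s = {K \<in> components s. K \<subseteq> W} \<union> {K \<in> components s. K \<subseteq> U - W}"
    using component_subset[OF assms(3)] partition_onD1[OF partition_on_components[OF assms(2)]] by blast
  moreover have "{K \<in> components s. K \<subseteq> W} \<inter> {K \<in> components s. K \<subseteq> U - W} = {}"
    using components_nonempty by blast
  ultimately have "card (components s) =
      card {K \<in> components s. K \<subseteq> W} + card {K \<in> components s. K \<subseteq> U - W}"
    using finite_components[OF assms(1,2)] by (metis card_Un_disjoint finite_Un)
  then show ?thesis
    using components_restr[OF assms(2,3)] components_restr[OF assms(2) closed_in_Diff[OF assms(2,3)]]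
    by (simp add: pi0_def)
qed

text \<open>Recognises the components among the closed sets by a condition on the cut-off piece
  alone, which is the form that \<open>sum_closed_in\<close> can use.\<close>

lemma pi0_restr_eq_1_iff:
  assumes "s \<in> qss U" "closed_in s W"
  shows "pi0 (restr s W) = 1 \<longleftrightarrow> W \<in> components s"
proof
  assume "pi0 (restr s W) = 1"
  then obtain K where "{K \<in> components s. K \<subseteq> W} = {K}"
    unfolding pi0_def components_restr[OF assms] by (auto simp: card_1_singleton_iff)
  then show "W \<in> components s" using Union_components_closed_in[OF assms] by auto
next
  assume W: "W \<in> components s"
  have "{K \<in> components s. K \<subseteq> W} = {W}"
  proof -
    have "K = W" if "K \<in> components s" "K \<subseteq> W" for K
      using component_subset[OF closed_in_component[OF assms(1) that(1)] W] that components_nonempty[OF that(1)]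
      by blast
    with W show ?thesis by auto
  qed
  then show "pi0 (restr s W) = 1" by (simp add: pi0_def components_restr[OF assms])
qed

lemma bij_betw_Union_components:
  assumes "s \<in> qss U"
  shows "bij_betw \<Union> (Pow (components s)) {W. closed_in s W}"
proof (rule bij_betw_byWitness[where f' = "\<lambda>W. {K \<in> components s. K \<subseteq> W}"])
  show "\<forall>B\<in>Pow (components s). {K \<in> components s. K \<subseteq> \<Union>B} = B"
  proof
    fix B assume B: "B \<in> Pow (components s)"
    have "K \<in> B" if K: "K \<in> components s" "K \<subseteq> \<Union>B" for K
    proof -
      obtain x where "x \<in> K" using components_nonempty[OF K(1)] by auto
      with K obtain L where "L \<in> B" "x \<in> L" by auto
      then have "K = L"
        using B K(1) \<open>x \<in> K\<close> partition_onD2[OF partition_on_components[OF assms]]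
        by (auto simp: disjoint_def)
      with \<open>L \<in> B\<close> show ?thesis by simp
    qed
    with B show "{K \<in> components s. K \<subseteq> \<Union>B} = B" by auto
  qed
  show "\<forall>W\<in>{W. closed_in s W}. \<Union> {K \<in> components s. K \<subseteq> W} = W"
    using Union_components_closed_in[OF assms] by simp
  show "\<Union> ` Pow (components s) \<subseteq> {W. closed_in s W}"
    using closed_in_Union[OF assms] by auto
qed auto

section \<open>Marked components and signed counts\<close>

definition qcount :: "(nat \<Rightarrow> bool) \<Rightarrow> 'a set \<Rightarrow> nat" where
  "qcount P U = card {s \<in> qss U. P (pi0 s)}"

lemma qcount_sum:
  assumes "finite U"
  shows "real (qcount P U) = (\<Sum>s\<in>qss U. of_bool (P (pi0 s)))"
  using finite_qss[OF assms] by (simp add: qcount_def Int_def)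

text \<open>Marking a component is choosing a closed set with connected restriction, and the rest
  then has one component fewer. The truncation in \<open>pi0 s - 1\<close> is harmless: when
  \<open>pi0 s = 0\<close> the inner sum is empty.\<close>

lemma sum_components:
  fixes f :: "nat \<Rightarrow> real"
  assumes "finite U"
  shows "(\<Sum>s\<in>qss U. of_bool (P (pi0 s - 1)) * (\<Sum>K\<in>components s. f (card K))) =
    (\<Sum>W\<in>Pow U. f (card W) * qcount (\<lambda>j. j = 1) W * qcount P (U - W))"
proof -
  let ?\<phi> = "\<lambda>W s t. f (card W) * of_bool (pi0 s = 1) * of_bool (P (pi0 t)) :: real"
  have "(\<Sum>W | closed_in s W. ?\<phi> W (restr s W) (restr s (U - W))) =
      of_bool (P (pi0 s - 1)) * (\<Sum>K\<in>components s. f (card K))" if s: "s \<in> qss U" for s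
  proof -
    have "(\<Sum>W | closed_in s W. ?\<phi> W (restr s W) (restr s (U - W))) =
      (\<Sum>K\<in>components s. ?\<phi> K (restr s K) (restr s (U - K)))"
      using closed_in_component[OF s] pi0_restr_eq_1_iff[OF s]
      by (intro sum.mono_neutral_right) (auto intro: finite_closed_in[OF assms s])
    also have "\<dots> = (\<Sum>K\<in>components s. of_bool (P (pi0 s - 1)) * f (card K))"
    proof (rule sum.cong)
      fix K assume K: "K \<in> components s"
      have "pi0 (restr s K) = 1" using pi0_restr_eq_1_iff[OF s closed_in_component[OF s K]] K by simp
      moreover from this have "pi0 (restr s (U - K)) = pi0 s - 1"
        using pi0_restr[OF assms s closed_in_component[OF s K]] by simp
      ultimately show "?\<phi> K (restr s K) (restr s (U - K)) = of_bool (P (pi0 s - 1)) * f (card K)"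
        by simp
    qed simp
    finally show ?thesis by (simp add: sum_distrib_left)
  qed
  then have "(\<Sum>s\<in>qss U. of_bool (P (pi0 s - 1)) * (\<Sum>K\<in>components s. f (card K))) =
      (\<Sum>s\<in>qss U. \<Sum>W | closed_in s W. ?\<phi> W (restr s W) (restr s (U - W)))"
    by simp
  also have "\<dots> = (\<Sum>W\<in>Pow U. \<Sum>s\<in>qss W. \<Sum>t\<in>qss (U - W). ?\<phi> W s t)"
    by (rule sum_closed_in[OF assms])
  also have "\<dots> = (\<Sum>W\<in>Pow U. f (card W) * qcount (\<lambda>j. j = 1) W * qcount P (U - W))"
  proof (rule sum.cong)
    fix W assume "W \<in> Pow U"
    then have "finite W" "finite (U - W)" using assms by (auto dest: finite_subset)
    then show "(\<Sum>s\<in>qss W. \<Sum>t\<in>qss (U - W). ?\<phi> W s t) =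
        f (card W) * qcount (\<lambda>j. j = 1) W * qcount P (U - W)"
      by (simp only: qcount_sum sum_distrib_left sum_distrib_right mult.assoc) (rule sum.swap)
  qed simp
  finally show ?thesis .
qed

text \<open>If C is the exponential generating function of connected surfaces, all surfaces have
  exp(C) and this signed count has exp(-C).\<close>

definition qsign :: "'a set \<Rightarrow> real" where
  "qsign U = (\<Sum>s\<in>qss U. (- 1) ^ pi0 s)"

lemma sum_Pow_signs: "finite A \<Longrightarrow> (\<Sum>B\<in>Pow A. (- 1) ^ card B) = (of_bool (A = {}) :: real)"
proof (cases "A = {}")
  case False
  assume "finite A"
  then have "(\<Sum>B\<in>Pow A. (- 1 :: real) ^ card B) = 0"
    using card_subsupersets_even_odd[of A "{}"] False by (intro sum_alternating_cancels) auto
  then show ?thesis using False by simp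
qed simp

text \<open>After gluing the two pieces together, each surface carries the sum of signs over all
  subsets of its components. This cancels unless there are no components, so only the empty surface
  survives.\<close>

lemma sum_qsign:
  assumes "finite U"
  shows "(\<Sum>W\<in>Pow U. qsign W * card (qss (U - W))) = of_bool (U = {})"
proof -
  have "(\<Sum>W\<in>Pow U. qsign W * card (qss (U - W))) =
      (\<Sum>W\<in>Pow U. \<Sum>s\<in>qss W. \<Sum>t\<in>qss (U - W). (- 1) ^ pi0 s)"
    unfolding qsign_def sum_distrib_right by (intro sum.cong refl) (simp add: mult.commute)
  also have "\<dots> = (\<Sum>s\<in>qss U. \<Sum>W | closed_in s W. (- 1) ^ pi0 (restr s W))"
    by (rule sum_closed_in[OF assms, symmetric])
  also have "\<dots> = (\<Sum>s\<in>qss U. of_bool (U = {}))"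
  proof (rule sum.cong)
    fix s assume s: "s \<in> qss U"
    have "(\<Sum>W | closed_in s W. (- 1 :: real) ^ pi0 (restr s W)) =
        (\<Sum>B\<in>Pow (components s). (- 1) ^ pi0 (restr s (\<Union>B)))"
      by (rule sum.reindex_bij_betw[OF bij_betw_Union_components[OF s], symmetric])
    also have "\<dots> = (\<Sum>B\<in>Pow (components s). (- 1) ^ card B)"
    proof (rule sum.cong)
      fix B assume B: "B \<in> Pow (components s)"
      \<comment> \<open>Both sides are sets of components with the same union, and
        \<open>\<Union>\<close> is injective on such sets.\<close>
      then have "{K \<in> components s. K \<subseteq> \<Union>B} = B"
        using bij_betw_Union_components[OF s] Union_components_closed_in[OF s] closed_in_Union[OF s]
        by (auto simp: bij_betw_def inj_on_def dest!: bspec[where x = "{K \<in> components s. K \<subseteq> \<Union>B}"])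
      then show "(- 1 :: real) ^ pi0 (restr s (\<Union>B)) = (- 1) ^ card B"
        using B components_restr[OF s closed_in_Union[OF s]] by (simp add: pi0_def)
    qed simp
    also have "\<dots> = of_bool (components s = {})"
      by (rule sum_Pow_signs[OF finite_components[OF assms s]])
    also have "components s = {} \<longleftrightarrow> U = {}"
      using qssD(1)[OF s] by (simp add: components_def)
    finally show "(\<Sum>W | closed_in s W. (- 1 :: real) ^ pi0 (restr s W)) = of_bool (U = {})" .
  qed simp
  also have "\<dots> = of_bool (U = {})"
  proof (cases "U = {}")
    case True
    have "qss U = {\<lparr>squares = {}, hglue = {}, vglue = {}\<rparr>}"
      using True by (auto simp: qss_def perfect_matching_def partition_on_empty intro: surface.equality)
    then show ?thesis using True by simp
  qed simp
  finally show ?thesis .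
qed

text \<open>A union bound: a surface counted on the left has at least one closed set of intermediate
  size, and the right side counts pairs of a surface and such a set. The hypothesis
  \<open>3 * r < card U\<close> excludes that a closed set with at most \<open>2 * r\<close> squares
  is already too large.\<close>

lemma card_qss_no_large:
  assumes "finite U" "3 * r < card U"
  shows "real (card {s \<in> qss U. P s \<and> (\<forall>K\<in>components s. card K + r < card U)}) \<le>
    (\<Sum>W | W \<subseteq> U \<and> r < card W \<and> card W + r < card U. real (card (qss W)) * real (card (qss (U - W))))"
proof -
  let ?g = "\<lambda>W. of_bool (r < card W \<and> card W + r < card U) :: real"
  have "of_bool (P s \<and> (\<forall>K\<in>components s. card K + r < card U)) \<le> (\<Sum>W | closed_in s W. ?g W)"
    if s: "s \<in> qss U" for s
  proof (cases "\<forall>K\<in>components s. card K + r < card U")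
    case True
    \<comment> \<open>A smallest union of components of size above \<open>r\<close>: removing a component from it leaves at
      most \<open>r\<close> squares, so if it has several components its size is at most \<open>2 * r\<close>.\<close>
    define W where "W = (ARG_MIN card W. closed_in s W \<and> r < card W)"
    have "closed_in s U \<and> r < card U" using closed_in_squares[OF s] assms(2) by simp
    then have W: "closed_in s W" "r < card W"
      and least: "\<And>V. closed_in s V \<Longrightarrow> r < card V \<Longrightarrow> card W \<le> card V"
      unfolding W_def using arg_min_nat_lemma[of "\<lambda>W. closed_in s W \<and> r < card W" U card] by auto
    have WU: "W \<subseteq> U" using W(1) qssD(1)[OF s] by (auto simp: closed_in_def)
    then have fW: "finite W" using assms(1) finite_subset by blast
    have "card W + r < card U"
    proof (rule ccontr)
      assume large: "\<not> card W + r < card U"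
      obtain K where K: "K \<in> components s" "K \<subseteq> W"
        using Union_components_closed_in[OF s W(1)] W(2) by (metis (no_types, lifting) Union_empty
            card.empty empty_Collect_eq not_less_zero)
      have cK: "closed_in s K" by (rule closed_in_component[OF s K(1)])
      have "closed_in s (W - K)"
        using W(1) closed_in_Diff[OF s cK] WU qssD(1)[OF s] unfolding closed_in_def by blast
      moreover have "card (W - K) < card W"
        using K components_nonempty[OF K(1)] fW by (intro psubset_card_mono) auto
      ultimately have "card (W - K) \<le> r" using least by force
      moreover have "card K + r < card U" using True K(1) by blast
      moreover have "card W = card (W - K) + card K"
        using K(2) fW by (simp add: card_Diff_subset card_mono finite_subset)
      moreover have "r < card K \<Longrightarrow> card W \<le> card K" using least[OF cK] by simp
      ultimately show False using large assms(2) by linarith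
    qed
    with W have "(1::real) \<le> (\<Sum>V\<in>{W}. ?g V)" by simp
    also have "\<dots> \<le> (\<Sum>W | closed_in s W. ?g W)"
      using W(1) by (intro sum_mono2 finite_closed_in[OF assms(1) s]) auto
    finally show ?thesis by (simp add: of_bool_def)
  qed (auto intro: sum_nonneg)
  then have "(\<Sum>s\<in>qss U. of_bool (P s \<and> (\<forall>K\<in>components s. card K + r < card U))) \<le>
      (\<Sum>s\<in>qss U. \<Sum>W | closed_in s W. ?g W)"
    by (rule sum_mono)
  also have "\<dots> = (\<Sum>W\<in>Pow U. \<Sum>s\<in>qss W. \<Sum>t\<in>qss (U - W). ?g W)"
    by (rule sum_closed_in[OF assms(1)])
  also have "\<dots> = (\<Sum>W\<in>Pow U. ?g W * real (card (qss W) * card (qss (U - W))))"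
    by (simp add: mult_ac)
  also have "\<dots> = (\<Sum>W | W \<subseteq> U \<and> r < card W \<and> card W + r < card U. real (card (qss W)) * real (card (qss (U - W))))"
    using assms(1) by (intro sum.mono_neutral_cong_right) auto
  finally show ?thesis
    using finite_qss[OF assms(1)] by (simp add: Int_def)
qed

subsection \<open>Counting surfaces by the number of squares\<close>

lemma finite_perfect_matchings: "finite S \<Longrightarrow> finite {M. perfect_matching S M}"
  by (rule finite_subset[of _ "Pow (Pow S)"]) (auto simp: perfect_matching_def partition_on_def)

lemma perfect_matching_doubleton: "x \<noteq> y \<Longrightarrow> perfect_matching {x, y} {{x, y}}"
  by (auto simp: perfect_matching_def partition_on_def)

text \<open>Classifies the matchings by the partner \<open>y\<close> of a fixed element
  \<open>x\<close>.\<close>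

lemma perfect_matchings_rec:
  assumes "x \<in> S"
  shows "{M. perfect_matching S M} =
    (\<Union>y\<in>S - {x}. insert {x, y} ` {M. perfect_matching (S - {x, y}) M})"
proof (intro equalityI subsetI)
  fix M assume "M \<in> {M. perfect_matching S M}"
  then have M: "perfect_matching S M" by simp
  then obtain e where e: "e \<in> M" "x \<in> e"
    using assms by (auto simp: perfect_matching_def partition_on_def)
  obtain p q where "e = {p, q}" "p \<noteq> q"
    using M e(1) by (auto simp: perfect_matching_def card_2_iff)
  then obtain y where y: "e = {x, y}" "x \<noteq> y"
    using e(2) by (metis insert_commute insert_iff empty_iff)
  then have "y \<in> S - {x}" using perfect_matchingD(1)[OF M e(1)] by auto
  have dis: "f \<inter> e = {}" if "f \<in> M" "f \<noteq> e" for f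
    using M e(1) that by (auto simp: perfect_matching_def partition_on_def disjoint_def)
  have "{f \<in> M. f \<subseteq> S - e} = M - {e}"
    using dis perfect_matchingD(1)[OF M] y by blast
  moreover have "perfect_matching (S - e) {f \<in> M. f \<subseteq> S - e}"
    using dis perfect_matchingD(1)[OF M] by (intro perfect_matching_restrict[OF M]) blast+
  ultimately have "perfect_matching (S - {x, y}) (M - {e})" using y by simp
  moreover have "M = insert {x, y} (M - {e})" using e y by auto
  ultimately show "M \<in> (\<Union>y\<in>S - {x}. insert {x, y} ` {M. perfect_matching (S - {x, y}) M})"
    using \<open>y \<in> S - {x}\<close> by blast
next
  fix M assume "M \<in> (\<Union>y\<in>S - {x}. insert {x, y} ` {M. perfect_matching (S - {x, y}) M})"
  then obtain y M' where y: "y \<in> S" "x \<noteq> y" "perfect_matching (S - {x, y}) M'" "M = insert {x, y} M'"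
    by auto
  have "perfect_matching ({x, y} \<union> (S - {x, y})) ({{x, y}} \<union> M')"
    by (intro perfect_matching_Un perfect_matching_doubleton y) auto
  moreover have "{x, y} \<union> (S - {x, y}) = S" using y assms by auto
  ultimately show "M \<in> {M. perfect_matching S M}" using y by simp
qed

lemma card_perfect_matchings:
  assumes "finite S" "card S = 2 * n"
  shows "card {M. perfect_matching S M} = double_fact (2 * n - 1)"
  using assms
proof (induction n arbitrary: S)
  case 0
  then have "{M. perfect_matching S M} = {{}}"
    by (auto simp: perfect_matching_def partition_on_empty)
  then show ?case by simp
next
  case (Suc n)
  then have "S \<noteq> {}" by auto
  then obtain x where x: "x \<in> S" by blast
  let ?F = "\<lambda>y. insert {x, y} ` {M. perfect_matching (S - {x, y}) M}"
  have cF: "card (?F y) = double_fact (2 * n - 1)" if y: "y \<in> S - {x}" for y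
  proof -
    have "inj_on (insert {x, y}) {M. perfect_matching (S - {x, y}) M}"
    proof (rule inj_onI)
      fix M N assume *: "M \<in> {M. perfect_matching (S - {x, y}) M}" "N \<in> {M. perfect_matching (S - {x, y}) M}"
        "insert {x, y} M = insert {x, y} N"
      have "{x, y} \<notin> L" if "perfect_matching (S - {x, y}) L" for L
        using perfect_matchingD(1)[OF that, of "{x, y}"] by blast
      with * have "{x, y} \<notin> M" "{x, y} \<notin> N" by simp_all
      then show "M = N" using *(3) insert_ident by metis
    qed
    moreover have "card (S - {x, y}) = 2 * n"
    proof -
      have "card {x, y} = 2" "{x, y} \<subseteq> S" using x y by auto
      then show ?thesis using Suc.prems by (simp add: card_Diff_subset)
    qed
    ultimately show ?thesis
      using Suc.IH[of "S - {x, y}"] Suc.prems by (simp add: card_image)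
  qed
  \<comment> \<open>A common matching would pair \<open>x\<close> with both \<open>y\<close> and
    \<open>z\<close>, although the edges of \<open>M\<close> avoid \<open>x\<close>.\<close>
  have "?F y \<inter> ?F z = {}" if "y \<in> S - {x}" "z \<in> S - {x}" "y \<noteq> z" for y z
  proof (rule ccontr)
    assume "?F y \<inter> ?F z \<noteq> {}"
    then obtain M N where MN: "insert {x, y} M = insert {x, z} N" "perfect_matching (S - {x, y}) M"
      by auto
    then have "{x, z} \<in> M" using that by (metis doubleton_eq_iff insert_iff)
    then show False using perfect_matchingD(1)[OF MN(2), of "{x, z}"] by auto
  qed
  then have "card (\<Union>y\<in>S - {x}. ?F y) = (\<Sum>y\<in>S - {x}. card (?F y))"
    using Suc.prems by (intro card_UN_disjoint) (auto intro!: finite_imageI finite_perfect_matchings)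
  also have "\<dots> = (2 * n + 1) * double_fact (2 * n - 1)"
    using Suc.prems x by (simp add: cF)
  \<comment> \<open>The case \<open>n = 0\<close> is separate because \<open>2 * n - 1\<close>
    truncates to 0 there.\<close>
  also have "\<dots> = double_fact (2 * Suc n - 1)"
    by (cases n) auto
  finally show ?case using perfect_matchings_rec[OF x] by simp
qed

lemma card_qss:
  fixes U :: "'a set"
  assumes "finite U"
  shows "card (qss U) = (double_fact (2 * card U - 1))\<^sup>2"
proof -
  let ?H = "{M. perfect_matching (U \<times> (UNIV :: hside set)) M}"
  let ?V = "{M. perfect_matching (U \<times> (UNIV :: vside set)) M}"
  have "bij_betw (\<lambda>(h, v). \<lparr>squares = U, hglue = h, vglue = v\<rparr>) (?H \<times> ?V) (qss U)"
    by (rule bij_betw_byWitness[where f' = "\<lambda>s. (hglue s, vglue s)"]) (auto simp: qss_def)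
  then have "card (qss U) = card ?H * card ?V"
    by (simp add: bij_betw_same_card[symmetric] card_cartesian_product)
  moreover have "card (U \<times> (UNIV :: hside set)) = 2 * card U" "card (U \<times> (UNIV :: vside set)) = 2 * card U"
    by (simp_all add: card_cartesian_product UNIV_hside UNIV_vside)
  moreover have "finite (U \<times> (UNIV :: hside set))" "finite (U \<times> (UNIV :: vside set))"
    using assms by (simp_all add: UNIV_hside UNIV_vside)
  ultimately show ?thesis
    by (simp add: card_perfect_matchings power2_eq_square)
qed

lemma double_fact_pos: "0 < double_fact n"
  by (induction n rule: double_fact.induct) auto

lemma double_fact_odd_Suc: "double_fact (2 * Suc n - 1) = (2 * n + 1) * double_fact (2 * n - 1)"
  by (cases n) auto

text \<open>Equivalent to saying that the square of the binomial coefficient is at most (2k+2l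
  choose 2k), being one term of Vandermonde's sum. The proof uses Pascal's rule instead: its two
  terms release the odd factors 2l-1 and 2k-1, whose sum 2(k+l)-2 is below the top factor 2(k+l)-1
  on the right.\<close>

lemma binomial_double_fact_le:
  "((k + l) choose k) * double_fact (2 * k - 1) * double_fact (2 * l - 1) \<le> double_fact (2 * (k + l) - 1)"
proof (induction "k + l" arbitrary: k l)
  case (Suc n)
  show ?case
  proof (cases "k = 0 \<or> l = 0")
    case False
    then obtain k' l' where kl: "k = Suc k'" "l = Suc l'" by (metis not0_implies_Suc)
    let ?d = "\<lambda>n. double_fact (2 * n - 1)"
    have n: "n = k' + l" "n = k + l'" using Suc.hyps(2) kl by auto
    have kl_Suc: "k + l = Suc n" using Suc.hyps(2) by simp
    have "(k + l) choose k = (n choose k) + (n choose k')"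
      using kl n by (simp add: add.commute)
    then have "((k + l) choose k) * ?d k * ?d l =
        (2 * l' + 1) * ((n choose k) * ?d k * ?d l') + (2 * k' + 1) * ((n choose k') * ?d k' * ?d l)"
      unfolding kl double_fact_odd_Suc by (simp only: algebra_simps)
    also have "\<dots> \<le> (2 * l' + 1) * ?d n + (2 * k' + 1) * ?d n"
      using Suc.hyps(1)[OF n(2)] Suc.hyps(1)[OF n(1)]
      by (intro add_mono mult_left_mono) (simp_all only: flip: n)
    also have "\<dots> \<le> (2 * n + 1) * ?d n"
      unfolding distrib_right[symmetric] using n kl by (intro mult_right_mono) auto
    also have "\<dots> = ?d (k + l)" using Suc.hyps(2) by (simp only: kl_Suc double_fact_odd_Suc)
    finally show ?thesis .
  qed auto
qed auto

section \<open>Labelled convolutions\<close>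

lemma sum_Pow_card:
  fixes f :: "nat \<Rightarrow> real"
  assumes "finite U"
  shows "(\<Sum>W\<in>Pow U. f (card W)) = (\<Sum>k\<le>card U. (card U choose k) * f k)"
proof -
  have "(\<Sum>W\<in>Pow U. f (card W)) = (\<Sum>k\<le>card U. \<Sum>W | W \<in> Pow U \<and> card W = k. f (card W))"
    using assms by (intro sum.group[symmetric]) (auto intro: card_mono)
  also have "\<dots> = (\<Sum>k\<le>card U. (card U choose k) * f k)"
    using assms by (intro sum.cong) (auto simp: n_subsets)
  finally show ?thesis .
qed

lemma sum_Pow_card_Diff:
  fixes f g :: "nat \<Rightarrow> real"
  assumes "finite U"
  shows "(\<Sum>W\<in>Pow U. f (card W) * g (card (U - W))) =
    (\<Sum>k\<le>card U. (card U choose k) * f k * g (card U - k))"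
proof -
  have "(\<Sum>W\<in>Pow U. f (card W) * g (card (U - W))) = (\<Sum>W\<in>Pow U. f (card W) * g (card U - card W))"
    using assms by (intro sum.cong) (auto simp: card_Diff_subset finite_subset)
  also have "\<dots> = (\<Sum>k\<le>card U. (card U choose k) * (f k * g (card U - k)))"
    by (rule sum_Pow_card[OF assms])
  finally show ?thesis by (simp add: mult.assoc)
qed

text \<open>A labelled convolution with an invertible factor determines the other factor. This replaces
  the transport of surfaces along a relabelling of the squares.\<close>

lemma convolution_card_invariant:
  fixes f :: "nat set \<Rightarrow> real" and g h :: "nat \<Rightarrow> real"
  assumes conv: "\<And>U. finite U \<Longrightarrow> (\<Sum>W\<in>Pow U. f W * g (card (U - W))) = h (card U)"
    and "g 0 \<noteq> 0"
  shows "finite U \<Longrightarrow> f U = f {1..card U}"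
proof (induction "card U" arbitrary: U rule: less_induct)
  case less
  \<comment> \<open>Isolates the term \<open>W = V\<close>; by induction all other terms depend on
    sizes only. The general \<open>V\<close> allows both \<open>U\<close> and
    \<open>{1..card U}\<close>.\<close>
  have split: "f V * g 0 = h (card V) - (\<Sum>k<card V. (card V choose k) * f {1..k} * g (card V - k))"
    if V: "finite V" "card V = card U" for V
  proof -
    \<comment> \<open>The value 0 at \<open>card V\<close> lets the sum over proper subsets extend
      to all of \<open>Pow V\<close>.\<close>
    let ?f = "\<lambda>k. if k < card V then f {1..k} else 0"
    have "(\<Sum>W\<in>Pow V - {V}. f W * g (card (V - W))) =
        (\<Sum>W\<in>Pow V - {V}. ?f (card W) * g (card (V - W)))"
    proof (rule sum.cong)
      fix W assume "W \<in> Pow V - {V}"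
      then have "W \<subset> V" by auto
      then have "finite W" "card W < card V"
        using V(1) by (auto intro: psubset_card_mono dest: finite_subset)
      then show "f W * g (card (V - W)) = ?f (card W) * g (card (V - W))"
        using less.hyps[of W] V by simp
    qed simp
    also have "\<dots> = (\<Sum>W\<in>Pow V. ?f (card W) * g (card (V - W)))"
      using V by (intro sum.mono_neutral_left) auto
    also have "\<dots> = (\<Sum>k\<le>card V. (card V choose k) * ?f k * g (card V - k))"
      by (rule sum_Pow_card_Diff[OF V(1)])
    also have "\<dots> = (\<Sum>k<card V. (card V choose k) * f {1..k} * g (card V - k))"
      by (intro sum.mono_neutral_cong_right) auto
    finally have "(\<Sum>W\<in>Pow V. f W * g (card (V - W))) =
        f V * g 0 + (\<Sum>k<card V. (card V choose k) * f {1..k} * g (card V - k))"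
      using V sum.remove[of "Pow V" V "\<lambda>W. f W * g (card (V - W))"] by simp
    then show ?thesis using conv[OF V(1)] by simp
  qed
  have "f U * g 0 = f {1..card U} * g 0"
    using split[of U] split[of "{1..card U}"] less.prems by simp
  then show ?case using \<open>g 0 \<noteq> 0\<close> by simp
qed

section \<open>Independence of the counts from the labels\<close>

definition surf_num :: "nat \<Rightarrow> real" where
  "surf_num n = real (card (qss {1..n}))"

definition comp_num :: "nat \<Rightarrow> nat \<Rightarrow> real" where
  "comp_num m n = real (qcount (\<lambda>j. j = m) {1..n})"

lemma card_qss_surf_num: "finite U \<Longrightarrow> real (card (qss U)) = surf_num (card U)"
  by (simp add: surf_num_def card_qss)

lemma surf_num_eq: "surf_num n = (real (double_fact (2 * n - 1)))\<^sup>2"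
  by (simp add: surf_num_def card_qss)

lemma surf_num_pos: "0 < surf_num n"
  using double_fact_pos by (simp add: surf_num_eq)

lemma qsign_card: "finite U \<Longrightarrow> qsign U = qsign {1..card U}" for U :: "nat set"
proof (rule convolution_card_invariant[where g = surf_num and h = "\<lambda>n. of_bool (n = 0)"])
  fix U :: "nat set" assume "finite U"
  then show "(\<Sum>W\<in>Pow U. qsign W * surf_num (card (U - W))) = of_bool (card U = 0)"
    using sum_qsign[of U] by (simp flip: card_qss_surf_num)
qed (use surf_num_pos[of 0] in auto)

lemma sum_card_components:
  assumes "finite U" "s \<in> qss U"
  shows "(\<Sum>K\<in>components s. card K) = card U"
proof -
  have U: "\<Union> (components s) = U"
    using partition_onD1[OF partition_on_components[OF assms(2)]] by simp
  then have "finite K" if "K \<in> components s" for K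
    using that assms(1) by (metis Union_upper finite_subset)
  then have "card (\<Union> (components s)) = (\<Sum>K\<in>components s. card K)"
    using partition_onD2[OF partition_on_components[OF assms(2)]]
    by (intro card_Union_disjoint) (auto simp: pairwise_def disjnt_def disjoint_def)
  then show ?thesis using U by simp
qed

text \<open>Weighted by size, the components of any surface add up to \<open>card U\<close>, so the
  size-weighted connected count convolved with \<open>surf_num\<close> is known: xA' = xC'A in
  generating functions. The weight \<open>card U\<close> is cancelled at the end, hence the separate
  empty case.\<close>

lemma qcount_1_card:
  fixes U :: "nat set"
  assumes "finite U"
  shows "real (qcount (\<lambda>j. j = 1) U) = comp_num 1 (card U)"
proof (cases "U = {}")
  case False
  have "real (card U) * qcount (\<lambda>j. j = 1) U = real (card {1..card U}) * qcount (\<lambda>j. j = 1) {1..card U}"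
  proof (rule convolution_card_invariant[where g = surf_num and h = "\<lambda>n. n * surf_num n"])
    fix U :: "nat set" assume U: "finite U"
    have "(\<Sum>W\<in>Pow U. real (card W) * qcount (\<lambda>j. j = 1) W * surf_num (card (U - W))) =
        (\<Sum>W\<in>Pow U. real (card W) * qcount (\<lambda>j. j = 1) W * qcount (\<lambda>_. True) (U - W))"
      using U by (simp add: qcount_def card_qss_surf_num)
    also have "\<dots> = (\<Sum>s\<in>qss U. of_bool True * (\<Sum>K\<in>components s. real (card K)))"
      using sum_components[OF U, of "\<lambda>_. True" real] by simp
    also have "\<dots> = card U * surf_num (card U)"
      using U sum_card_components[OF U] by (simp add: card_qss_surf_num flip: of_nat_sum)
    finally show "(\<Sum>W\<in>Pow U. real (card W) * qcount (\<lambda>j. j = 1) W * surf_num (card (U - W))) =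
        card U * surf_num (card U)" .
  qed (use surf_num_pos[of 0] assms in auto)
  then show ?thesis using False assms by (simp add: comp_num_def)
qed (simp add: comp_num_def)

text \<open>Marking one of the \<open>Suc m\<close> components reduces the claim to connected
  surfaces and to surfaces with \<open>m\<close> components.\<close>

lemma qcount_eq_card:
  fixes U :: "nat set"
  assumes "finite U"
  shows "real (qcount (\<lambda>j. j = m) U) = comp_num m (card U)"
  using assms
proof (induction m arbitrary: U)
  case 0
  have z: "qcount (\<lambda>j. j = 0) V = of_bool (V = {}) * card (qss V)" if "finite V" for V :: "nat set"
  proof -
    have "pi0 s = 0 \<longleftrightarrow> V = {}" if "s \<in> qss V" for s
      using finite_components[OF \<open>finite V\<close> that] qssD(1)[OF that] by (simp add: pi0_def components_def)
    then have "{s \<in> qss V. pi0 s = 0} = (if V = {} then qss V else {})" by auto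
    then show ?thesis by (simp add: qcount_def)
  qed
  show ?case using z[OF 0] z[of "{1..card U}"] 0
    by (cases "U = {}") (simp_all add: comp_num_def Suc_le_eq card_gt_0_iff)
next
  case (Suc m)
  have rec: "Suc m * real (qcount (\<lambda>j. j = Suc m) V) =
      (\<Sum>k\<le>card V. (card V choose k) * comp_num 1 k * comp_num m (card V - k))" if V: "finite V" for V :: "nat set"
  proof -
    have "Suc m * real (qcount (\<lambda>j. j = Suc m) V) = (\<Sum>s\<in>qss V. real (Suc m) * of_bool (pi0 s = Suc m))"
      by (simp only: qcount_sum[OF V] sum_distrib_left)
    \<comment> \<open>When \<open>m = 0\<close>, surfaces with \<open>pi0 s = 0\<close> also pass
      the truncated test, but their inner sum is 0.\<close>
    also have "\<dots> = (\<Sum>s\<in>qss V. of_bool (pi0 s - 1 = m) * (\<Sum>K\<in>components s. 1))"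
      by (intro sum.cong) (auto simp: pi0_def)
    also have "\<dots> = (\<Sum>W\<in>Pow V. comp_num 1 (card W) * comp_num m (card (V - W)))"
      using sum_components[OF V, of "\<lambda>j. j = m" "\<lambda>_. 1"] V Suc.IH qcount_1_card
      by (auto intro!: sum.cong simp: finite_subset)
    also have "\<dots> = (\<Sum>k\<le>card V. (card V choose k) * comp_num 1 k * comp_num m (card V - k))"
      by (rule sum_Pow_card_Diff[OF V])
    finally show ?thesis .
  qed
  have "Suc m * real (qcount (\<lambda>j. j = Suc m) U) = Suc m * real (qcount (\<lambda>j. j = Suc m) {1..card U})"
    using rec[OF Suc.prems] rec[of "{1..card U}"] by simp
  then show ?case by (simp add: comp_num_def)
qed

text \<open>The decomposition of the label set can be read off the pair through
  \<open>squares\<close>, so summing over \<open>W\<close> counts every pair exactly once. The even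
  count minus the odd count then becomes \<open>qsign\<close>.\<close>

lemma qss_coeff_sum:
  "real_of_int (qss_coeff k m) =
    (\<Sum>W\<in>Pow {1..k}. real (qcount (\<lambda>j. j = m - 1) W) * qsign ({1..k} - W))"
proof -
  define pairs where "pairs P = {(s', s''). \<exists>i\<in>{0..k}. (s', s'') \<in> qss_prod i (k - i) \<and> pi0 s' = m - 1 \<and> P (pi0 s'')}"
    for P :: "nat \<Rightarrow> bool"
  have card_pairs: "card (pairs P) = (\<Sum>W\<in>Pow {1..k}. qcount (\<lambda>j. j = m - 1) W * qcount P ({1..k} - W))" for P
  proof -
    let ?S = "SIGMA W:Pow {1..k}. {s \<in> qss W. pi0 s = m - 1} \<times> {t \<in> qss ({1..k} - W). P (pi0 t)}"
    have "pairs P = snd ` ?S"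
    proof (intro equalityI subsetI)
      fix p assume "p \<in> pairs P"
      then obtain i s t U V where p: "p = (s, t)" "i \<le> k" "U \<union> V = {1..i + (k - i)}" "U \<inter> V = {}"
        "s \<in> qss U" "t \<in> qss V" "pi0 s = m - 1" "P (pi0 t)"
        by (auto simp: pairs_def qss_prod_def)
      then have "U \<subseteq> {1..k}" "V = {1..k} - U" by auto
      with p have "(U, s, t) \<in> ?S" by auto
      then show "p \<in> snd ` ?S" by (rule rev_image_eqI) (simp add: p(1))
    next
      fix p assume "p \<in> snd ` ?S"
      then obtain W s t where p: "p = (s, t)" "W \<subseteq> {1..k}" "s \<in> qss W" "t \<in> qss ({1..k} - W)"
        "pi0 s = m - 1" "P (pi0 t)" by auto
      have "card W \<le> k" using card_mono[OF _ p(2)] by simp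
      moreover have "(s, t) \<in> qss_prod (card W) (k - card W)"
        unfolding qss_prod_def mem_Collect_eq prod.case
        using p \<open>card W \<le> k\<close>
        by (intro exI[of _ W] exI[of _ "{1..k} - W"]) (auto simp: card_Diff_subset finite_subset)
      ultimately show "p \<in> pairs P" using p by (auto simp: pairs_def)
    qed
    moreover have "inj_on snd ?S"
      by (auto simp: inj_on_def dest!: qssD(1))
    ultimately have "card (pairs P) = card ?S" by (simp add: card_image)
    also have "\<dots> = (\<Sum>W\<in>Pow {1..k}. card ({s \<in> qss W. pi0 s = m - 1} \<times> {t \<in> qss ({1..k} - W). P (pi0 t)}))"
      by (intro card_SigmaI)
        (auto intro!: finite_cartesian_product finite_subset[OF Collect_subset finite_qss]
          intro: finite_subset[OF _ finite_atLeastAtMost])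
    finally show ?thesis by (simp add: qcount_def card_cartesian_product)
  qed
  have sign: "qsign V = real (qcount even V) - real (qcount odd V)" if "finite V" for V :: "nat set"
  proof -
    have "(- 1) ^ j = (of_bool (even j) - of_bool (odd j) :: real)" for j :: nat by simp
    then show ?thesis by (simp add: qsign_def qcount_sum[OF that] sum_subtractf)
  qed
  have "real_of_int (qss_coeff k m) = real (card (pairs even)) - real (card (pairs odd))"
    by (simp add: qss_coeff_def pairs_def)
  also have "\<dots> = (\<Sum>W\<in>Pow {1..k}. real (qcount (\<lambda>j. j = m - 1) W) * qsign ({1..k} - W))"
    by (simp add: card_pairs sign sum_subtractf right_diff_distrib)
  finally show ?thesis .
qed

subsection \<open>The giant component\<close>

text \<open>The error term: surfaces in which every component misses more than \<open>r\<close>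
  squares. Writing \<open>card K + r < n\<close> avoids a truncated difference.\<close>

definition scattered :: "(nat \<Rightarrow> bool) \<Rightarrow> nat \<Rightarrow> nat \<Rightarrow> real" where
  "scattered P r n =
     real (card {s \<in> qss {1..n}. P (pi0 s) \<and> (\<forall>K\<in>components s. card K + r < n)})"

text \<open>Two such components would be disjoint and together have at least
  \<open>2 * (card U - r)\<close> squares, more than there are.\<close>

lemma card_large_components_le_1:
  assumes "finite U" "s \<in> qss U" "2 * r < card U"
  shows "card {K \<in> components s. card U \<le> card K + r} \<le> 1"
proof -
  have "K = L" if "K \<in> components s" "L \<in> components s" "card U \<le> card K + r" "card U \<le> card L + r" for K L
  proof (rule ccontr)
    assume "K \<noteq> L"
    then have "K \<inter> L = {}"
      using partition_onD2[OF partition_on_components[OF assms(2)]] that by (auto simp: disjoint_def)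
    moreover have "K \<union> L \<subseteq> U"
      using partition_onD1[OF partition_on_components[OF assms(2)]] that by blast
    ultimately have "card K + card L \<le> card U"
      using assms(1) by (metis card_Un_disjoint card_mono finite_Un finite_subset)
    then show False using that assms(3) by linarith
  qed
  moreover have "finite {K \<in> components s. card U \<le> card K + r}"
    using finite_components[OF assms(1,2)] by simp
  ultimately show ?thesis by (subst card_le_Suc0_iff_eq[folded One_nat_def]) auto
qed

text \<open>Here \<open>j\<close> is the number of squares outside the giant component, and
  \<open>q j\<close> counts the admissible remainders. The abstract \<open>Q\<close> and
  \<open>q\<close> cover both all surfaces and those with \<open>m\<close> components.\<close>

lemma giant_component:
  fixes q :: "nat \<Rightarrow> real"
  assumes q: "\<And>U :: nat set. finite U \<Longrightarrow> real (qcount (\<lambda>j. Q (Suc j)) U) = q (card U)"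
    and "2 * r < n"
  shows "real (qcount Q {1..n}) = (\<Sum>j\<le>r. (n choose j) * q j * comp_num 1 (n - j)) + scattered Q r n"
proof -
  let ?U = "{1..n}"
  let ?f = "\<lambda>k. of_bool (n \<le> k + r) :: real"
  \<comment> \<open>The sum over components counts the giant ones, so it is 0 or 1. When it is 1,
    \<open>pi0 s > 0\<close> and \<open>Suc (pi0 s - 1)\<close> is \<open>pi0 s\<close>.\<close>
  have split: "of_bool (Q (pi0 s)) = of_bool (Q (Suc (pi0 s - 1))) * (\<Sum>K\<in>components s. ?f (card K)) +
      of_bool (Q (pi0 s) \<and> (\<forall>K\<in>components s. card K + r < n))" if s: "s \<in> qss ?U" for s
  proof -
    let ?L = "{K \<in> components s. n \<le> card K + r}"
    have fin: "finite (components s)" using finite_components[OF _ s] by simp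
    have sum: "(\<Sum>K\<in>components s. ?f (card K)) = card ?L"
      using fin by (simp add: Int_def)
    show ?thesis
    proof (cases "?L = {}")
      case True
      then have "\<forall>K\<in>components s. card K + r < n" by force
      then show ?thesis using sum True by simp
    next
      case False
      have "card ?L \<le> 1" using card_large_components_le_1[OF _ s, of r] assms(2) by simp
      moreover have "card ?L \<noteq> 0" using fin False by simp
      ultimately have "card ?L = 1" by linarith
      moreover have "components s \<noteq> {}" "\<not> (\<forall>K\<in>components s. card K + r < n)" using False by force+
      moreover from this have "pi0 s > 0" using fin by (simp add: pi0_def card_gt_0_iff)
      ultimately show ?thesis using sum by simp
    qed
  qed
  have "(\<Sum>s\<in>qss ?U. of_bool (Q (Suc (pi0 s - 1))) * (\<Sum>K\<in>components s. ?f (card K))) =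
      (\<Sum>W\<in>Pow ?U. ?f (card W) * qcount (\<lambda>j. j = 1) W * qcount (\<lambda>j. Q (Suc j)) (?U - W))"
    using sum_components[of ?U "\<lambda>j. Q (Suc j)" ?f] by simp
  also have "\<dots> = (\<Sum>W\<in>Pow ?U. (?f (card W) * comp_num 1 (card W)) * q (card (?U - W)))"
  proof (rule sum.cong)
    fix W assume "W \<in> Pow ?U"
    then have "finite W" "finite (?U - W)" by (auto dest: finite_subset)
    then show "?f (card W) * qcount (\<lambda>j. j = 1) W * qcount (\<lambda>j. Q (Suc j)) (?U - W) =
        (?f (card W) * comp_num 1 (card W)) * q (card (?U - W))"
      by (simp only: q qcount_1_card)
  qed simp
  also have "\<dots> = (\<Sum>k\<le>n. (n choose k) * (?f k * comp_num 1 k) * q (n - k))"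
    using sum_Pow_card_Diff[of ?U "\<lambda>k. ?f k * comp_num 1 k" q] by simp
  also have "\<dots> = (\<Sum>j\<le>n. (n choose (n - j)) * (?f (n - j) * comp_num 1 (n - j)) * q j)"
    by (rule sum.reindex_bij_witness[where i = "\<lambda>k. n - k" and j = "\<lambda>k. n - k"]) auto
  also have "\<dots> = (\<Sum>j\<le>r. (n choose j) * q j * comp_num 1 (n - j))"
    using assms(2) by (intro sum.mono_neutral_cong_right) (auto simp: binomial_symmetric[symmetric])
  finally have "(\<Sum>s\<in>qss ?U. of_bool (Q (Suc (pi0 s - 1))) * (\<Sum>K\<in>components s. ?f (card K))) = \<dots>" .
  moreover have "scattered Q r n =
      (\<Sum>s\<in>qss ?U. of_bool (Q (pi0 s) \<and> (\<forall>K\<in>components s. card K + r < n)))"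
    using finite_qss[of ?U] by (simp add: scattered_def Int_def)
  moreover have "real (qcount Q ?U) = (\<Sum>s\<in>qss ?U. of_bool (Q (pi0 s)))"
    by (rule qcount_sum) simp
  ultimately show ?thesis by (simp add: split sum.distrib)
qed

section \<open>Surfaces without a giant component are rare\<close>

lemma surf_num_product_le:
  assumes "k \<le> n"
  shows "(real (n choose k))\<^sup>2 * (surf_num k * surf_num (n - k)) \<le> surf_num n"
proof -
  let ?d = "\<lambda>n. double_fact (2 * n - 1)"
  have "(n choose k) * ?d k * ?d (n - k) \<le> ?d n"
    using binomial_double_fact_le[of k "n - k"] assms by simp
  then have "real (n choose k) * real (?d k) * real (?d (n - k)) \<le> real (?d n)"
    by (metis of_nat_le_iff of_nat_mult)
  then have "(real (n choose k) * real (?d k) * real (?d (n - k)))\<^sup>2 \<le> (real (?d n))\<^sup>2"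
    by (intro power_mono) auto
  then show ?thesis by (simp add: surf_num_eq power_mult_distrib mult.assoc)
qed

text \<open>For each size \<open>k\<close> there are \<open>n choose k\<close> label sets. As a
  surface consists of two matchings, \<open>surf_num_product_le\<close> gains the square of that
  number, which leaves one inverse binomial coefficient.\<close>

lemma scattered_le:
  assumes "3 * r < n"
  shows "scattered P r n \<le> surf_num n * (\<Sum>k\<in>{r<..<n - r}. 1 / (n choose k))"
proof -
  let ?b = "\<lambda>k. of_bool (r < k \<and> k + r < n) :: real"
  have "scattered P r n \<le> (\<Sum>W | W \<subseteq> {1..n} \<and> r < card W \<and> card W + r < n.
      real (card (qss W)) * real (card (qss ({1..n} - W))))"
    using card_qss_no_large[of "{1..n}" r "\<lambda>s. P (pi0 s)"] assms by (simp add: scattered_def)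
  also have "\<dots> = (\<Sum>W\<in>Pow {1..n}. (?b (card W) * surf_num (card W)) * surf_num (card ({1..n} - W)))"
    by (intro sum.mono_neutral_cong_left) (auto simp: card_qss_surf_num finite_subset[of _ "{Suc 0..n}"])
  also have "\<dots> = (\<Sum>k\<le>n. (n choose k) * (?b k * surf_num k) * surf_num (n - k))"
    using sum_Pow_card_Diff[of "{1..n}" "\<lambda>k. ?b k * surf_num k" surf_num] by simp
  also have "\<dots> = (\<Sum>k\<in>{r<..<n - r}. (n choose k) * surf_num k * surf_num (n - k))"
    by (intro sum.mono_neutral_cong_right) auto
  also have "\<dots> \<le> (\<Sum>k\<in>{r<..<n - r}. surf_num n * (1 / (n choose k)))"
  proof (rule sum_mono)
    fix k assume "k \<in> {r<..<n - r}"
    then have "k \<le> n" by auto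
    then show "(n choose k) * surf_num k * surf_num (n - k) \<le> surf_num n * (1 / (n choose k))"
      using surf_num_product_le[of k n] by (simp add: field_simps power2_eq_square zero_less_binomial)
  qed
  finally show ?thesis by (simp add: sum_distrib_left)
qed

lemma inverse_binomial_le:
  assumes "0 < k" "k \<le> n"
  shows "1 / real (n choose k) \<le> real k ^ k / real n ^ k"
proof -
  have "(real n / real k) ^ k \<le> real (n choose k)" by (rule binomial_ge_n_over_k_pow_k[OF assms(2)])
  moreover have "0 < (real n / real k) ^ k" using assms by simp
  ultimately have "1 / real (n choose k) \<le> 1 / (real n / real k) ^ k" by (intro frac_le) auto
  then show ?thesis by (simp add: power_divide)
qed

lemma binomial_mono_central:
  assumes "j \<le> k" "k + j \<le> n"
  shows "n choose j \<le> n choose k"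
proof (cases "2 * k \<le> n")
  case False
  then have "n choose j \<le> n choose (n - k)" using assms by (intro binomial_mono) auto
  then show ?thesis using assms by (simp add: binomial_symmetric[symmetric])
qed (use assms binomial_mono in auto)

text \<open>The two end terms \<open>k = Suc r\<close> and \<open>k = n - Suc r\<close> have the
  claimed order. Each of the fewer than \<open>n\<close> others is smaller by a further factor of
  order 1/n, so together they do not exceed it.\<close>

lemma sum_inverse_binomial_bigo:
  "(\<lambda>n. \<Sum>k\<in>{r<..<n - r}. 1 / real (n choose k)) \<in> O(\<lambda>n. 1 / real n ^ Suc r)"
proof (rule bigoI)
  let ?A = "real (Suc r) ^ Suc r" and ?B = "real (Suc (Suc r)) ^ Suc (Suc r)"
  show "\<forall>\<^sub>F n in at_top. norm (\<Sum>k\<in>{r<..<n - r}. 1 / real (n choose k)) \<le>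
      (2 * ?A + ?B) * norm (1 / real n ^ Suc r)"
    using eventually_gt_at_top[of "2 * r + 4"]
  proof eventually_elim
    case (elim n)
    have n: "0 < real n" using elim by simp
    let ?a = "?A / real n ^ Suc r" and ?b = "?B / real n ^ Suc (Suc r)"
    \<comment> \<open>The indicators select the two end terms; \<open>?b\<close> bounds the others
      and, being nonnegative, may be added throughout.\<close>
    have "1 / real (n choose k) \<le> (of_bool (k = Suc r) + of_bool (k = n - Suc r)) * ?a + ?b"
      if k: "k \<in> {r<..<n - r}" for k
    proof (cases "k = Suc r \<or> k = n - Suc r")
      case True
      then have "n choose k = n choose Suc r"
        using elim binomial_symmetric[of "Suc r" n] by auto
      then have "1 / real (n choose k) \<le> ?a"
        using inverse_binomial_le[of "Suc r" n] elim by simp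
      also have "\<dots> \<le> (of_bool (k = Suc r) + of_bool (k = n - Suc r)) * ?a + ?b"
      proof -
        have "(1::real) \<le> of_bool (k = Suc r) + of_bool (k = n - Suc r)" using True by auto
        then have "1 * ?a \<le> (of_bool (k = Suc r) + of_bool (k = n - Suc r)) * ?a"
          by (rule mult_right_mono) simp
        moreover have "0 \<le> ?b" by simp
        ultimately show ?thesis by linarith
      qed
      finally show ?thesis .
    next
      case False
      then have "n choose Suc (Suc r) \<le> n choose k"
        using k by (intro binomial_mono_central) auto
      then have "1 / real (n choose k) \<le> 1 / real (n choose Suc (Suc r))"
        using elim by (intro frac_le) (auto simp: zero_less_binomial)
      also have "\<dots> \<le> ?b" using inverse_binomial_le[of "Suc (Suc r)" n] elim by simp
      finally show ?thesis using False by simp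
    qed
    then have "(\<Sum>k\<in>{r<..<n - r}. 1 / real (n choose k)) \<le>
        (\<Sum>k\<in>{r<..<n - r}. (of_bool (k = Suc r) + of_bool (k = n - Suc r)) * ?a + ?b)"
      by (rule sum_mono)
    also have "\<dots> \<le> (\<Sum>k<n. (of_bool (k = Suc r) + of_bool (k = n - Suc r)) * ?a + ?b)"
      by (intro sum_mono2) auto
    also have "\<dots> = 2 * ?a + n * ?b"
    proof -
      have delta: "(\<Sum>k<n. of_bool (k = j) * c) = c" if "j < n" for j and c :: real
      proof -
        have "(\<Sum>k<n. of_bool (k = j) * c) = (\<Sum>k<n. if k = j then c else 0)"
          by (intro sum.cong) auto
        then show ?thesis using that by simp
      qed
      have "Suc r < n" "n - Suc r < n" using elim by auto
      then show ?thesis by (simp only: sum.distrib distrib_right delta) simp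
    qed
    also have "\<dots> = (2 * ?A + ?B) * (1 / real n ^ Suc r)"
      using n by (simp add: field_simps)
    finally show ?case using n by (simp add: sum_nonneg)
  qed
qed

lemma scattered_bigo: "(\<lambda>n. scattered P r n / surf_num n) \<in> O(\<lambda>n. 1 / real n ^ Suc r)"
proof (rule landau_o.big_trans[OF _ sum_inverse_binomial_bigo])
  show "(\<lambda>n. scattered P r n / surf_num n) \<in> O(\<lambda>n. \<Sum>k\<in>{r<..<n - r}. 1 / real (n choose k))"
  proof (rule bigoI[where c = 1])
    show "\<forall>\<^sub>F n in at_top. norm (scattered P r n / surf_num n) \<le>
        1 * norm (\<Sum>k\<in>{r<..<n - r}. 1 / real (n choose k))"
      using eventually_gt_at_top[of "3 * r"]
    proof eventually_elim
      case (elim n)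
      then show ?case
        using scattered_le[OF elim, of P] surf_num_pos[of n]
        by (simp add: scattered_def sum_nonneg field_simps)
    qed
  qed
qed

section \<open>Order of growth of the scale functions\<close>

lemma qss_scale_eq:
  assumes "k \<le> n"
  shows "qss_scale k n = (n choose k) * surf_num (n - k) / surf_num n"
  by (simp add: qss_scale_def surf_num_eq power_divide)

lemma double_fact_ratio_le:
  "k \<le> n \<Longrightarrow> double_fact (2 * n - 1) \<le> (2 * n) ^ k * double_fact (2 * (n - k) - 1)"
proof (induction k)
  case (Suc k)
  then have nk: "n - k = Suc (n - Suc k)" by simp
  have "double_fact (2 * n - 1) \<le> (2 * n) ^ k * double_fact (2 * (n - k) - 1)" using Suc by simp
  also have "\<dots> = (2 * n) ^ k * ((2 * (n - Suc k) + 1) * double_fact (2 * (n - Suc k) - 1))"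
    unfolding nk double_fact_odd_Suc ..
  also have "\<dots> \<le> (2 * n) ^ k * ((2 * n) * double_fact (2 * (n - Suc k) - 1))"
    using Suc.prems by (intro mult_left_mono mult_right_mono) auto
  finally show ?case by (simp add: mult_ac)
qed simp

text \<open>From above, the product bound gives at most \<open>1 / (n choose k)\<close>. From below,
  the ratio of double factorials is at least \<open>1 / (2 * n) ^ k\<close>; its square times the
  binomial coefficient, of order \<open>n ^ k\<close>, has the right order. Both bounds divide by
  \<open>k\<close>, so \<open>k = 0\<close> is treated apart.\<close>

lemma qss_scale_bigtheta: "qss_scale k \<in> \<Theta>(\<lambda>n. 1 / real n ^ k)"
proof (cases "k = 0")
  case True
  have "surf_num n \<noteq> 0" for n using surf_num_pos[of n] by simp
  then have "qss_scale 0 = (\<lambda>n. 1)" by (simp add: qss_scale_eq fun_eq_iff)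
  then show ?thesis using True by simp
next
  case False
  show ?thesis
  proof (rule bigthetaI)
    show "qss_scale k \<in> O(\<lambda>n. 1 / real n ^ k)"
    proof (rule bigoI[where c = "real k ^ k"])
      show "\<forall>\<^sub>F n in at_top. norm (qss_scale k n) \<le> real k ^ k * norm (1 / real n ^ k)"
        using eventually_gt_at_top[of k]
      proof eventually_elim
        case (elim n)
        have "1 \<le> surf_num k"
          using double_fact_pos[of "2 * k - 1"] by (simp add: surf_num_eq Suc_le_eq)
        then have "(real (n choose k))\<^sup>2 * (1 * surf_num (n - k)) \<le>
            (real (n choose k))\<^sup>2 * (surf_num k * surf_num (n - k))"
          using surf_num_pos by (intro mult_left_mono mult_right_mono) (auto intro: less_imp_le)
        also have "\<dots> \<le> surf_num n" using surf_num_product_le[of k n] elim by simp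
        finally have "qss_scale k n \<le> 1 / real (n choose k)"
          using elim surf_num_pos[of n]
          by (simp add: qss_scale_eq field_simps power2_eq_square zero_less_binomial)
        also have "\<dots> \<le> real k ^ k / real n ^ k"
          using False elim by (intro inverse_binomial_le) auto
        finally show ?case by (simp add: qss_scale_def)
      qed
    qed
    show "qss_scale k \<in> \<Omega>(\<lambda>n. 1 / real n ^ k)"
    \<comment> \<open>The constant comes from
      \<open>n / k * (1 / (2 * n))\<^sup>2 = 1 / (4 * k * n)\<close>, raised to the power
      \<open>k\<close>.\<close>
    proof (rule landau_omega.bigI[where c = "1 / (4 * real k) ^ k"])
      show "\<forall>\<^sub>F n in at_top. 1 / (4 * real k) ^ k * norm (1 / real n ^ k) \<le> norm (qss_scale k n)"
        using eventually_gt_at_top[of k]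
      proof eventually_elim
        case (elim n)
        let ?d = "\<lambda>n. double_fact (2 * n - 1)"
        have n: "0 < real n" "0 < real (?d n)" "0 < real (?d (n - k))" using elim double_fact_pos by auto
        have "real (?d n) \<le> real ((2 * n) ^ k * ?d (n - k))"
          using double_fact_ratio_le[of k n] elim by (subst of_nat_le_iff) simp
        then have "real (?d n) \<le> (2 * real n) ^ k * real (?d (n - k))" by simp
        then have "1 / (2 * real n) ^ k \<le> real (?d (n - k)) / real (?d n)"
          using n by (simp add: pos_divide_le_eq pos_le_divide_eq mult.commute)
        then have "(1 / (2 * real n) ^ k)\<^sup>2 \<le> (real (?d (n - k)) / real (?d n))\<^sup>2"
          using n by (intro power_mono) auto
        moreover have "(real n / real k) ^ k \<le> real (n choose k)"
          using elim by (intro binomial_ge_n_over_k_pow_k) auto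
        ultimately have "(real n / real k) ^ k * (1 / (2 * real n) ^ k)\<^sup>2 \<le> qss_scale k n"
          unfolding qss_scale_def by (intro mult_mono) auto
        moreover have "(real n / real k) ^ k * (1 / (2 * real n) ^ k)\<^sup>2 = 1 / (4 * real k) ^ k * (1 / real n ^ k)"
        proof -
          have "(real n / real k) ^ k * (1 / (2 * real n) ^ k)\<^sup>2 = (real n / real k * (1 / (2 * real n))\<^sup>2) ^ k"
          proof -
            have sq: "(x ^ k)\<^sup>2 = (x\<^sup>2) ^ k" for x :: real by (simp add: mult.commute flip: power_mult)
            have inv: "1 / x ^ k = (1 / x) ^ k" for x :: real by (simp add: power_one_over)
            show ?thesis by (simp only: inv sq) (simp only: power_mult_distrib)
          qed
          also have "real n / real k * (1 / (2 * real n))\<^sup>2 = 1 / (4 * real k) * (1 / real n)"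
            using n False by (simp add: power2_eq_square field_simps)
          finally show ?thesis by (simp add: power_mult_distrib power_divide)
        qed
        ultimately show ?case by (simp add: qss_scale_def)
      qed
    qed (use False in simp)
  qed
qed

section \<open>Generating functions and the exact error formula\<close>

definition egf :: "(nat \<Rightarrow> real) \<Rightarrow> real fps" where
  "egf x = Abs_fps (\<lambda>n. x n / fact n)"

text \<open>Labelled convolution becomes a product of power series, so associativity and inverses
  require no nested sums.\<close>

lemma egf_mult:
  fixes x y :: "nat \<Rightarrow> real"
  shows "egf x * egf y = egf (\<lambda>n. \<Sum>k\<le>n. (n choose k) * x k * y (n - k))"
proof (rule fps_ext)
  fix n
  show "fps_nth (egf x * egf y) n = fps_nth (egf (\<lambda>n. \<Sum>k\<le>n. (n choose k) * x k * y (n - k))) n"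
    by (simp add: egf_def fps_mult_nth atLeast0AtMost sum_divide_distrib binomial_fact field_simps)
qed

lemma egf_inject: "egf x = egf y \<longleftrightarrow> x = y"
  by (auto simp: egf_def fps_eq_iff)

text \<open>The series of the coefficients is that of \<open>comp_num (m - 1)\<close> times that of
  the signed count, and the latter is inverse to the series of \<open>surf_num\<close>.\<close>

lemma qss_coeff_convolution:
  "(\<Sum>k\<le>n. (n choose k) * real_of_int (qss_coeff k m) * surf_num (n - k)) = comp_num (m - 1) n"
proof -
  let ?e = "\<lambda>n. qsign {1..n :: nat}"
  have "real_of_int (qss_coeff k m) = (\<Sum>i\<le>k. (k choose i) * comp_num (m - 1) i * ?e (k - i))" for k
  proof -
    have "real_of_int (qss_coeff k m) = (\<Sum>W\<in>Pow {1..k}. comp_num (m - 1) (card W) * ?e (card ({1..k} - W)))"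
      unfolding qss_coeff_sum
    proof (rule sum.cong)
      fix W assume "W \<in> Pow {1..k}"
      then have "finite W" "finite ({1..k} - W)" by (auto dest: finite_subset)
      then show "real (qcount (\<lambda>j. j = m - 1) W) * qsign ({1..k} - W) =
          comp_num (m - 1) (card W) * ?e (card ({1..k} - W))"
        using qcount_eq_card qsign_card by metis
    qed simp
    also have "\<dots> = (\<Sum>i\<le>k. (k choose i) * comp_num (m - 1) i * ?e (k - i))"
      using sum_Pow_card_Diff[of "{1..k}" "comp_num (m - 1)" ?e] by simp
    finally show ?thesis .
  qed
  then have d: "egf (\<lambda>k. real_of_int (qss_coeff k m)) = egf (comp_num (m - 1)) * egf ?e"
    by (simp only: egf_mult)
  have "(\<Sum>k\<le>n. (n choose k) * ?e k * surf_num (n - k)) = of_bool (n = 0)" for n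
  proof -
    have "(\<Sum>k\<le>n. (n choose k) * ?e k * surf_num (n - k)) =
        (\<Sum>W\<in>Pow {1..n}. ?e (card W) * surf_num (card ({1..n} - W)))"
      using sum_Pow_card_Diff[of "{1..n}" ?e surf_num] by simp
    also have "\<dots> = (\<Sum>W\<in>Pow {1..n}. qsign W * card (qss ({1..n} - W)))"
    proof (rule sum.cong)
      fix W assume "W \<in> Pow {1..n}"
      then have "finite W" "finite ({1..n} - W)" by (auto dest: finite_subset)
      then show "?e (card W) * surf_num (card ({1..n} - W)) = qsign W * card (qss ({1..n} - W))"
        using card_qss_surf_num qsign_card by metis
    qed simp
    also have "\<dots> = of_bool (n = 0)" by (subst sum_qsign) auto
    finally show ?thesis .
  qed
  then have "egf ?e * egf surf_num = egf (\<lambda>n. of_bool (n = 0))"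
    by (simp only: egf_mult)
  also have "\<dots> = 1" by (auto simp: egf_def fps_eq_iff)
  finally have "egf (\<lambda>k. real_of_int (qss_coeff k m)) * egf surf_num = egf (comp_num (m - 1))"
    by (simp add: d mult.assoc)
  then show ?thesis unfolding egf_mult egf_inject by (rule fun_cong)
qed

text \<open>Expanding each \<open>surf_num (n - k)\<close> by its giant component and collecting
  terms by the total number \<open>l = k + j\<close> of squares outside it, the inner sum is
  \<open>qss_coeff_convolution\<close>. This reproduces the main terms of
  \<open>comp_num m n\<close>, so only \<open>scattered\<close> terms remain.\<close>

lemma comp_num_expansion:
  assumes "0 < m" "2 * r < n"
  defines "d \<equiv> \<lambda>k. real_of_int (qss_coeff k m)"
  shows "comp_num m n - (\<Sum>k\<le>r. d k * (n choose k) * surf_num (n - k)) =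
    scattered (\<lambda>j. j = m) r n -
    (\<Sum>k\<le>r. d k * (n choose k) * scattered (\<lambda>_. True) (r - k) (n - k))"
proof -
  have N: "comp_num m n = (\<Sum>j\<le>r. (n choose j) * comp_num (m - 1) j * comp_num 1 (n - j)) +
      scattered (\<lambda>j. j = m) r n"
    unfolding comp_num_def[of m n]
  proof (rule giant_component[where Q = "\<lambda>j. j = m" and q = "comp_num (m - 1)", OF _ assms(2)])
    have "(\<lambda>j. Suc j = m) = (\<lambda>j. j = m - 1)" using assms(1) by auto
    then show "real (qcount (\<lambda>j. Suc j = m) U) = comp_num (m - 1) (card U)" if "finite U" for U :: "nat set"
      using qcount_eq_card[OF that] by simp
  qed
  \<comment> \<open>Truncating at \<open>r - k\<close> makes exactly the pairs with
    \<open>k + j \<le> r\<close> appear; \<open>2 * (r - k) < n - k\<close> follows from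
    \<open>2 * r < n\<close>.\<close>
  have a: "surf_num (n - k) = (\<Sum>j\<le>r - k. ((n - k) choose j) * surf_num j * comp_num 1 (n - k - j)) +
      scattered (\<lambda>_. True) (r - k) (n - k)" if "k \<le> r" for k
  proof -
    have "real (qcount (\<lambda>_. True) {1..n - k}) =
        (\<Sum>j\<le>r - k. ((n - k) choose j) * surf_num j * comp_num 1 (n - k - j)) +
        scattered (\<lambda>_. True) (r - k) (n - k)"
      by (rule giant_component) (use assms(2) that in \<open>auto simp: qcount_def card_qss_surf_num\<close>)
    then show ?thesis by (simp add: qcount_def surf_num_def)
  qed
  have "(\<Sum>k\<le>r. d k * (n choose k) * (surf_num (n - k) - scattered (\<lambda>_. True) (r - k) (n - k))) =
      (\<Sum>k\<le>r. \<Sum>j\<le>r - k. d k * (n choose k) * (((n - k) choose j) * surf_num j * comp_num 1 (n - k - j)))"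
    by (intro sum.cong) (auto simp: a sum_distrib_left)
  also have "\<dots> = (\<Sum>k\<le>r. \<Sum>j\<le>r - k.
      (n choose (k + j)) * comp_num 1 (n - (k + j)) * (((k + j) choose k) * d k * surf_num j))"
  proof (intro sum.cong refl)
    fix k j assume "k \<in> {..r}" "j \<in> {..r - k}"
    then have "(n choose (k + j)) * ((k + j) choose k) = (n choose k) * ((n - k) choose j)"
      using choose_mult[of k "k + j" n] assms(2) by simp
    then have "real (n choose (k + j)) * ((k + j) choose k) = real (n choose k) * ((n - k) choose j)"
      by (metis of_nat_mult)
    then show "d k * (n choose k) * (((n - k) choose j) * surf_num j * comp_num 1 (n - k - j)) =
        (n choose (k + j)) * comp_num 1 (n - (k + j)) * (((k + j) choose k) * d k * surf_num j)"
      by (simp add: algebra_simps)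
  qed
  also have "\<dots> = (\<Sum>(k, j)\<in>{(k, j). k + j \<le> r}.
      (n choose (k + j)) * comp_num 1 (n - (k + j)) * (((k + j) choose k) * d k * surf_num j))"
    by (subst sum.Sigma) (auto intro!: sum.cong)
  also have "\<dots> = (\<Sum>l\<le>r. \<Sum>k\<le>l. (n choose l) * comp_num 1 (n - l) * ((l choose k) * d k * surf_num (l - k)))"
    by (subst sum.triangle_reindex_eq) (auto intro!: sum.cong)
  also have "\<dots> = (\<Sum>l\<le>r. (n choose l) * comp_num 1 (n - l) * comp_num (m - 1) l)"
    by (simp add: d_def qss_coeff_convolution flip: sum_distrib_left)
  finally show ?thesis unfolding N
    by (simp add: right_diff_distrib sum_subtractf mult_ac)
qed

section \<open>Assembling the expansion\<close>

lemma inverse_power_shift_bigo: "(\<lambda>n. 1 / real (n - k) ^ q) \<in> O(\<lambda>n. 1 / real n ^ q)"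
proof (rule bigoI[where c = "2 ^ q"])
  show "\<forall>\<^sub>F n in at_top. norm (1 / real (n - k) ^ q) \<le> 2 ^ q * norm (1 / real n ^ q)"
    using eventually_gt_at_top[of "2 * k"]
  proof eventually_elim
    case (elim n)
    then have "real n / 2 \<le> real (n - k)" "0 < real n" by auto
    then have "1 / real (n - k) ^ q \<le> 1 / (real n / 2) ^ q"
      using elim by (intro divide_left_mono power_mono mult_pos_pos zero_less_power) auto
    then show ?case by (simp add: power_divide)
  qed
qed

theorem proposition4p12:
  fixes m :: nat
  assumes "m > 0"
  shows "asymptotic_expansion
    (\<lambda>n. measure_pmf.prob (pmf_of_set (qss {1..n})) {s. pi0 s = m})
    (\<lambda>k. real_of_int (qss_coeff k m))
    qss_scale"
  unfolding asymptotic_expansion_def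
proof (intro conjI allI)
  fix k
  have "(\<lambda>n. 1 / real n ^ Suc k) \<in> o(\<lambda>n. 1 / real n ^ k)"
  proof (rule smalloI_tendsto)
    have "(\<lambda>n. 1 / real n) \<longlonglongrightarrow> 0" by (rule lim_1_over_n)
    then show "(\<lambda>n. (1 / real n ^ Suc k) / (1 / real n ^ k)) \<longlonglongrightarrow> 0"
      by (rule Lim_transform_eventually)
        (use eventually_gt_at_top[of 0] in \<open>eventually_elim, simp add: field_simps\<close>)
    show "\<forall>\<^sub>F n in sequentially. 1 / real n ^ k \<noteq> 0"
      using eventually_gt_at_top[of 0] by eventually_elim simp
  qed
  then show "qss_scale (Suc k) \<in> o(qss_scale k)"
    using qss_scale_bigtheta by (metis landau_o.small.cong_bigtheta landau_o.small.in_cong_bigtheta)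
next
  fix r
  let ?d = "\<lambda>k. real_of_int (qss_coeff k m)"
  let ?p = "\<lambda>n. measure_pmf.prob (pmf_of_set (qss {1..n})) {s. pi0 s = m}"
  let ?\<beta> = "\<lambda>P r n. scattered P r n / surf_num n"
  \<comment> \<open>This is the right side of \<open>comp_num_expansion\<close> divided by
    \<open>surf_num n\<close>; the factor \<open>surf_num (n - k)\<close> in
    \<open>qss_scale k n\<close> cancels the denominator of the shifted quotient.\<close>
  let ?err = "\<lambda>n. ?\<beta> (\<lambda>j. j = m) r n - (\<Sum>k\<le>r. ?d k * (qss_scale k n * ?\<beta> (\<lambda>_. True) (r - k) (n - k)))"
  have "?err \<in> O(\<lambda>n. 1 / real n ^ Suc r)"
  proof (intro sum_in_bigo big_sum_in_bigo scattered_bigo)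
    \<comment> \<open>The scale contributes order \<open>k\<close> in 1/n and the scattered part
      order \<open>Suc (r - k)\<close>, in total \<open>Suc r\<close>.\<close>
    fix k assume k: "k \<in> {..r}"
    have "(\<lambda>n. ?\<beta> (\<lambda>_. True) (r - k) (n - k)) \<in> O(\<lambda>n. 1 / real (n - k) ^ Suc (r - k))"
      by (rule landau_o.big.compose[OF scattered_bigo filterlim_minus_const_nat_at_top])
    then have "(\<lambda>n. ?\<beta> (\<lambda>_. True) (r - k) (n - k)) \<in> O(\<lambda>n. 1 / real n ^ Suc (r - k))"
      using inverse_power_shift_bigo landau_o.big_trans by blast
    moreover have "qss_scale k \<in> O(\<lambda>n. 1 / real n ^ k)"
      using qss_scale_bigtheta by (rule bigthetaD1)
    ultimately have "(\<lambda>n. qss_scale k n * ?\<beta> (\<lambda>_. True) (r - k) (n - k)) \<in>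
        O(\<lambda>n. 1 / real n ^ k * (1 / real n ^ Suc (r - k)))"
      by (intro landau_o.big.mult)
    also have "(\<lambda>n. 1 / real n ^ k * (1 / real n ^ Suc (r - k))) = (\<lambda>n. 1 / real n ^ Suc r)"
      using k by (auto simp flip: power_add)
    finally show "(\<lambda>n. ?d k * (qss_scale k n * ?\<beta> (\<lambda>_. True) (r - k) (n - k))) \<in> O(\<lambda>n. 1 / real n ^ Suc r)"
      by (cases "?d k = 0") (simp, simp only: landau_o.big.cmult_in_iff not_False_eq_True)
  qed
  moreover have "\<forall>\<^sub>F n in at_top. ?p n - (\<Sum>k\<le>r. ?d k * qss_scale k n) = ?err n"
    using eventually_gt_at_top[of "2 * r"]
  proof eventually_elim
    case (elim n)
    have pos: "surf_num j \<noteq> 0" for j using surf_num_pos[of j] by simp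
    have p: "?p n = comp_num m n / surf_num n"
      using measure_pmf_of_set[OF qss_nonempty finite_qss, of "{1..n}" "{s. pi0 s = m}"]
      by (simp add: comp_num_def qcount_def surf_num_def Int_def)
    have "(\<Sum>k\<le>r. ?d k * qss_scale k n) = (\<Sum>k\<le>r. ?d k * (n choose k) * surf_num (n - k)) / surf_num n"
      using elim by (simp add: sum_divide_distrib qss_scale_eq mult.assoc)
    moreover have "(\<Sum>k\<le>r. ?d k * (qss_scale k n * ?\<beta> (\<lambda>_. True) (r - k) (n - k))) =
        (\<Sum>k\<le>r. ?d k * (n choose k) * scattered (\<lambda>_. True) (r - k) (n - k)) / surf_num n"
      using elim pos by (simp add: sum_divide_distrib qss_scale_eq mult.assoc)
    ultimately show ?case
      using comp_num_expansion[OF assms elim] unfolding p by (simp flip: diff_divide_distrib)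
  qed
  ultimately have "(\<lambda>n. ?p n - (\<Sum>k\<le>r. ?d k * qss_scale k n)) \<in> O(\<lambda>n. 1 / real n ^ Suc r)"
    by (subst landau_o.big.in_cong)
  then show "(\<lambda>n. ?p n - (\<Sum>k\<le>r. ?d k * qss_scale k n)) \<in> O(qss_scale (Suc r))"
    using landau_o.big.cong_bigtheta[OF qss_scale_bigtheta] by blast
qed

end
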